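(* Let $\mathcal D\subset\mathbb{R}^2$ be a fixed Borel set, let $u(\bm s)=\int_{\mathcal D}G(\|\bm s-\bm t\|)\,\mathcal M(\mathrm d\bm t)$ be a well-defined moving average process, and suppose that (i) $G:\mathbb{R}_+\to\mathbb{R}_+$ is non-negative, continuous, strictly decreasing and convex; (ii) there is $\beta>0$ such that for any bounded Borel set $B\subset\mathcal D$ of positive Lebesgue measure, the random variable $\mathcal M(B)$ has an absolutely continuous distribution function $F_{\mathcal M(B)}$ with exponential tail $\bar F_{\mathcal M(B)}\in\mathscr L_\beta$. Let $u_n$ be the integral approximation of $u$ based on a triangulation of $D_n\subset\mathcal D$ with set of mesh nodes $M_n=\{\bm a_n^i,\ i=1,\dots,m_n\}$ (as described in the context). Let $\bm s_1\neq\bm s_2$ be points of $\mathcal D$, let $h=\|\bm s_1-\bm s_2\|$, and let $\eta_n(h)$ be the residual tail dependence coefficient of $(u_n(\bm s_1),u_n(\bm s_2))$. If $m_n\to\infty$ and the sequence of mesh nodes $M_n$ is dense in $\mathcal D$, then the limit of $\eta_n(h)$ as $n\to\infty$ is $$\eta(h)=\frac12+\frac{G(h)}{2G(0)}.$$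
   Context: Exponential tails: for a distribution function $F$, $\bar F=1-F$. A function $g:\mathbb{R}\to\mathbb{R}_+$ with $\lim_{x\to\infty}g(x)=0$ belongs to $\mathscr L_\beta$ if $\lim_{x\to\infty}g(x-t)/g(x)=\exp(t\beta)$ for all $t\in\mathbb{R}$. Moving average process: $\mathcal M$ is an independently scattered random measure (its values on disjoint bounded Borel sets are independent), and $G$ is assumed $\mathcal M$-integrable, so that the stochastic integral $u(\bm s)$ is well defined as a limit in probability of integrals of simple functions. Integral approximation: $\{D_n:D_n\subset\mathcal D\}$ is an increasing sequence of bounded Borel sets in $\mathbb{R}^2$; $D_n^1,\dots,D_n^J\subset D_n$ (with $J$ depending on $n$) is a partition of $D_n$ obtained by triangulating $D_n$ with $m_n$ mesh nodes $M_n=\{\bm a_n^i,\ i=1,\dots,m_n\}$; points $\bm d_i\in D_n^i$ are chosen, and $$u_n(\bm s)=\int_{\mathcal D}\sum_{i=1}^J G(\|\bm s-\bm d_i\|)1_{D_n^i}(\bm t)\,\mathcal M(\mathrm d\bm t)=\sum_{i=1}^J G(\|\bm s-\bm d_i\|)\,\mathcal M(D_n^i).$$ The sequence $M_n$ is dense in $\mathcal D$ if for any $\bm s\in\mathcal D$ there is a sequence $\bar{\bm a}_n\in M_n$ with $\lim_{n\to\infty}\|\bar{\bm a}_n-\bm s\|=0$. Residual tail dependence coefficient: for a random vector $(X_1,X_2)$ with marginal distribution functions $F_{X_1},F_{X_2}$, $\eta=\lim_{q\uparrow1}\log(1-q)/\log\Pr(F_{X_1}(X_1)>q,F_{X_2}(X_2)>q)$,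 provided the limit exists.
   Formalization: The formal theorem adds that mesh cells meeting any compact subset of the interior of D have diameters tending uniformly to 0; dense nodes alone allow long sliver triangles and choices of d_i for which the limit is 1 instead. *)

theory Defs
  imports "HOL-Probability.Probability"
begin

text \<open>The class of exponential tails; the limit for \<open>t = 0\<close> forces \<open>g x \<noteq> 0\<close> for all large \<open>x\<close>,
  so that the convention \<open>y / 0 = 0\<close> plays no role.\<close>

definition exp_tail_class :: "real \<Rightarrow> (real \<Rightarrow> real) set" where
  "exp_tail_class \<beta> = {g. (\<forall>x. 0 \<le> g x) \<and> (g \<longlongrightarrow> 0) at_top \<and>
     (\<forall>t. ((\<lambda>x. g (x - t) / g x) \<longlongrightarrow> exp (t * \<beta>)) at_top)}"

definition distr_fun :: "'w measure \<Rightarrow> ('w \<Rightarrow> real) \<Rightarrow> real \<Rightarrow> real" where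
  "distr_fun P X = cdf (distr P borel X)"

definition abs_continuous_df :: "(real \<Rightarrow> real) \<Rightarrow> bool" where
  "abs_continuous_df F \<longleftrightarrow>
     (\<exists>f. (\<forall>t. 0 \<le> f t) \<and> integrable lborel f \<and> (\<forall>x. F x = (LINT t:{..x}|lborel. f t)))"

definition tendsto_in_probability ::
  "'w measure \<Rightarrow> (nat \<Rightarrow> 'w \<Rightarrow> real) \<Rightarrow> ('w \<Rightarrow> real) \<Rightarrow> bool" where
  "tendsto_in_probability P X Y \<longleftrightarrow>
     (\<forall>\<epsilon>>0. (\<lambda>n. measure P {\<omega> \<in> space P. \<epsilon> < \<bar>X n \<omega> - Y \<omega>\<bar>}) \<longlonglongrightarrow> 0)"


text \<open>Random measures on \<open>D\<close> are indexed by the delta-ring of bounded Borel subsets of \<open>D\<close>;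
  on an unbounded set \<open>M\<close> need not have a value.\<close>

definition bounded_borel_subsets :: "'a::euclidean_space set \<Rightarrow> 'a set set" where
  "bounded_borel_subsets D = {B \<in> sets borel. B \<subseteq> D \<and> bounded B}"

definition independently_scattered ::
  "'w measure \<Rightarrow> 'a::euclidean_space set \<Rightarrow> ('a set \<Rightarrow> 'w \<Rightarrow> real) \<Rightarrow> bool" where
  "independently_scattered P D M \<longleftrightarrow>
     (\<forall>B \<in> bounded_borel_subsets D. M B \<in> borel_measurable P) \<and>
     (\<forall>A :: nat \<Rightarrow> 'a set. range A \<subseteq> bounded_borel_subsets D \<and> disjoint_family A \<longrightarrow>
        prob_space.indep_vars P (\<lambda>_. borel) (\<lambda>i. M (A i)) UNIV \<and>
        (bounded (\<Union>i. A i) \<longrightarrow> (AE \<omega> in P. (\<lambda>i. M (A i) \<omega>) sums M (\<Union>i. A i) \<omega>)))"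


text \<open>The integral in the sense of Rajput and Rosinski. ``Almost everywhere'' refers to the
  control measure of \<open>M\<close>, whose null sets are those on all bounded Borel parts of which \<open>M\<close>
  vanishes almost surely.\<close>

definition random_null_set ::
  "'w measure \<Rightarrow> 'a::euclidean_space set \<Rightarrow> ('a set \<Rightarrow> 'w \<Rightarrow> real) \<Rightarrow> 'a set \<Rightarrow> bool" where
  "random_null_set P D M N \<longleftrightarrow> N \<in> sets borel \<and> N \<subseteq> D \<and>
     (\<forall>B \<in> bounded_borel_subsets N. AE \<omega> in P. M B \<omega> = 0)"

definition simple_integrand :: "'a::euclidean_space set \<Rightarrow> ('a \<Rightarrow> real) \<Rightarrow> bool" where
  "simple_integrand D f \<longleftrightarrow>
     f \<in> borel_measurable borel \<and> finite (f ` D) \<and> bounded {t \<in> D. f t \<noteq> 0}"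

definition simple_random_integral ::
  "('a::euclidean_space set \<Rightarrow> 'w \<Rightarrow> real) \<Rightarrow> 'a set \<Rightarrow> ('a \<Rightarrow> real) \<Rightarrow> 'w \<Rightarrow> real" where
  "simple_random_integral M A f \<omega> = (\<Sum>y \<in> f ` A - {0}. y * M {t \<in> A. f t = y} \<omega>)"

definition has_random_integral ::
  "'w measure \<Rightarrow> 'a::euclidean_space set \<Rightarrow> ('a set \<Rightarrow> 'w \<Rightarrow> real) \<Rightarrow> ('a \<Rightarrow> real) \<Rightarrow>
   ('w \<Rightarrow> real) \<Rightarrow> bool" where
  "has_random_integral P D M f X \<longleftrightarrow> X \<in> borel_measurable P \<and>
     (\<exists>F. (\<forall>n. simple_integrand D (F n)) \<and>
          (\<exists>N. random_null_set P D M N \<and> (\<forall>t \<in> D - N. (\<lambda>n. F n t) \<longlonglongrightarrow> f t)) \<and>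
          (\<forall>A \<in> sets borel. A \<subseteq> D \<longrightarrow> (\<exists>Y \<in> borel_measurable P.
             tendsto_in_probability P (\<lambda>n. simple_random_integral M A (F n)) Y)) \<and>
          tendsto_in_probability P (\<lambda>n. simple_random_integral M D (F n)) X)"

definition moving_average ::
  "'w measure \<Rightarrow> 'a::euclidean_space set \<Rightarrow> ('a set \<Rightarrow> 'w \<Rightarrow> real) \<Rightarrow> (real \<Rightarrow> real) \<Rightarrow>
   ('a \<Rightarrow> 'w \<Rightarrow> real) \<Rightarrow> bool" where
  "moving_average P D M G u \<longleftrightarrow>
     (\<forall>s \<in> D. has_random_integral P D M (\<lambda>t. G (norm (s - t))) (u s))"


text \<open>\<open>C 1, \<dots>, C J\<close> is a partition of \<open>B\<close> coming from a (face-to-face) triangulation of \<open>B\<close>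
  whose set of vertices is \<open>N\<close>. Neighbouring closed triangles share edges or vertices, so a
  partition has to assign each boundary point to at most one of them: a cell consists of the
  interior of its triangle together with some part of the boundary.\<close>

definition triangulated_partition ::
  "(real^2) set \<Rightarrow> (real^2) set \<Rightarrow> nat \<Rightarrow> (nat \<Rightarrow> (real^2) set) \<Rightarrow> bool" where
  "triangulated_partition B N J C \<longleftrightarrow>
     (\<exists>T :: nat \<Rightarrow> (real^2) set. triangulation (T ` {1..J}) \<and>
        N = {a. \<exists>i \<in> {1..J}. a extreme_point_of T i} \<and>
        (\<forall>i \<in> {1..J}. 2 simplex T i \<and> interior (T i) \<subseteq> C i \<and> C i \<subseteq> T i)) \<and>
     (\<forall>i \<in> {1..J}. C i \<in> sets borel) \<and>
     disjoint_family_on C {1..J} \<and> (\<Union>i \<in> {1..J}. C i) = B"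

text \<open>The mesh width tends to zero locally uniformly in the interior of \<open>D\<close>. For meshes with
  dense nodes this holds if the triangles are uniformly non-degenerate or Delaunay; it excludes
  meshes such as those built from \<open>(\<epsilon>, 0)\<close> and \<open>(1, \<epsilon>)\<close> with \<open>1 / \<epsilon>\<close> integral, whose nodes are
  the fine lattice \<open>\<epsilon> \<int>\<^sup>2\<close> although all triangles have diameter at least 1.\<close>

definition locally_fine ::
  "(real^2) set \<Rightarrow> (nat \<Rightarrow> nat) \<Rightarrow> (nat \<Rightarrow> nat \<Rightarrow> (real^2) set) \<Rightarrow> bool" where
  "locally_fine D J C \<longleftrightarrow>
     (\<forall>K. compact K \<and> K \<subseteq> interior D \<longrightarrow>
        (\<forall>\<epsilon>>0. \<forall>\<^sub>F n in sequentially.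
           \<forall>i \<in> {1..J n}. C n i \<inter> K \<noteq> {} \<longrightarrow> diameter (C n i) < \<epsilon>))"

definition dense_nodes :: "'a::metric_space set \<Rightarrow> (nat \<Rightarrow> 'a set) \<Rightarrow> bool" where
  "dense_nodes D N \<longleftrightarrow>
     (\<forall>s \<in> D. \<exists>a. (\<forall>n. a n \<in> N n) \<and> (\<lambda>n. dist (a n) s) \<longlonglongrightarrow> 0)"

definition integral_approx ::
  "('a::euclidean_space set \<Rightarrow> 'w \<Rightarrow> real) \<Rightarrow> (real \<Rightarrow> real) \<Rightarrow> nat \<Rightarrow> (nat \<Rightarrow> 'a set) \<Rightarrow>
   (nat \<Rightarrow> 'a) \<Rightarrow> 'a \<Rightarrow> 'w \<Rightarrow> real" where
  "integral_approx M G J C d s \<omega> = (\<Sum>i = 1..J. G (norm (s - d i)) * M (C i) \<omega>)"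


definition has_residual_tail_dependence ::
  "'w measure \<Rightarrow> ('w \<Rightarrow> real) \<Rightarrow> ('w \<Rightarrow> real) \<Rightarrow> real \<Rightarrow> bool" where
  "has_residual_tail_dependence P X Y \<eta> \<longleftrightarrow>
     ((\<lambda>q. ln (1 - q) /
           ln (measure P {\<omega> \<in> space P. q < distr_fun P X (X \<omega>) \<and> q < distr_fun P Y (Y \<omega>)}))
        \<longlongrightarrow> \<eta>) (at_left 1)"

end

theory Submission
  imports Defs "HOL-Real_Asymp.Real_Asymp"
begin

text \<open>For fixed \<open>n\<close> the two approximations are positive linear combinations \<open>\<Sum> a i * Z i\<close> and
  \<open>\<Sum> b i * Z i\<close> of independent variables with tails \<open>exp (- \<beta> x + o(x))\<close>. With \<open>A = max a\<close> and
  \<open>B = max b\<close>, the cheapest way for both sums to exceed \<open>t A / \<beta>\<close> and \<open>t B / \<beta>\<close> is a linear program,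
  so that the joint tail is \<open>exp (- t / V + o(t))\<close> where \<open>V\<close> is its dual value, the minimum over
  \<open>w\<close> in \<open>[0, 1]\<close> of \<open>max_i (w a i / A + (1 - w) b i / B)\<close>: a dual solution gives a Chernoff bound, a
  primal solution gives a lower bound by independence. The marginal tails are \<open>exp (- t + o(t))\<close>, hence
  \<open>V\<close> is the residual tail dependence coefficient. As the mesh gets fine, convexity and monotonicity
  of \<open>G\<close> bound \<open>V\<close> from above (\<open>w = 1 / 2\<close>) by \<open>(G 0 + G h) / (2 G 0)\<close> in the limit, and the cells
  closest to the two sites bound it from below by the same value.\<close>

subsection \<open>A minimax identity and a convexity inequality\<close>

text \<open>The minimax theorem for a matrix game with two rows: \<open>p\<close> and
  \<open>w\<close> are optimal strategies and \<open>V\<close> is the value. \<open>V\<close> is the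
  maximum of the smaller coordinate over the hull of the points \<open>(a i, b i)\<close>. The open
  quadrant above \<open>(V, V)\<close> misses the hull, and the normalised normal of a separating
  line gives \<open>w\<close>.\<close>

lemma minimax_two_rows:
  fixes a b :: "'i \<Rightarrow> real"
  assumes I: "finite I" "I \<noteq> {}"
  obtains p w V where "\<And>i. i \<in> I \<Longrightarrow> 0 \<le> p i" "sum p I = 1" "0 \<le> w" "w \<le> 1"
    "V \<le> (\<Sum>i\<in>I. p i * a i)" "V \<le> (\<Sum>i\<in>I. p i * b i)"
    "\<And>i. i \<in> I \<Longrightarrow> w * a i + (1 - w) * b i \<le> V"
proof -
  define H where "H = convex hull ((\<lambda>i. (a i, b i)) ` I)"
  \<comment> \<open>Weights are indexed by \<open>I\<close> and not by points of the image, since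
    different \<open>i\<close> may give the same point. The inclusion \<open>H \<subseteq> W\<close>
    proved below supplies \<open>p\<close> for the maximiser.\<close>
  define W where "W = {(\<Sum>i\<in>I. p i * a i, \<Sum>i\<in>I. p i * b i) | p. (\<forall>i\<in>I. 0 \<le> p i) \<and> sum p I = 1}"
  have "compact H" "H \<noteq> {}" "convex H"
    using I by (auto simp: H_def finite_imp_compact_convex_hull)
  have W_conv: "convex W"
  proof (rule convexI)
    fix x y and u v :: real
    assume "x \<in> W" "y \<in> W" and uv: "0 \<le> u" "0 \<le> v" "u + v = 1"
    then obtain p q where
      p: "x = (\<Sum>i\<in>I. p i * a i, \<Sum>i\<in>I. p i * b i)" "\<forall>i\<in>I. 0 \<le> p i" "sum p I = 1" and
      q: "y = (\<Sum>i\<in>I. q i * a i, \<Sum>i\<in>I. q i * b i)" "\<forall>i\<in>I. 0 \<le> q i" "sum q I = 1"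
      by (auto simp: W_def)
    show "u *\<^sub>R x + v *\<^sub>R y \<in> W"
      unfolding W_def using p q uv
      by (intro CollectI exI[of _ "\<lambda>i. u * p i + v * q i"])
        (auto simp: sum.distrib sum_distrib_left algebra_simps simp flip: sum_distrib_left)
  qed
  have "H \<subseteq> W"
    unfolding H_def
  proof (rule hull_minimal)
    show "convex W" by (fact W_conv)
    show "(\<lambda>i. (a i, b i)) ` I \<subseteq> W"
    proof clarify
      fix i assume "i \<in> I"
      moreover have "(\<Sum>j\<in>I. (if j = i then 1 else 0) * f j) = f i" for f :: "'i \<Rightarrow> real"
        using I \<open>i \<in> I\<close> by (simp add: if_distrib[of "\<lambda>x. x * _"] cong: if_cong)
      ultimately show "(a i, b i) \<in> W"
        unfolding W_def using I
        by (intro CollectI exI[of _ "\<lambda>j. if j = i then 1 else 0"]) auto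
    qed
  qed
  have "continuous_on H (\<lambda>x. min (fst x) (snd x))"
    by (intro continuous_intros)
  then obtain q where q: "q \<in> H" "\<And>x. x \<in> H \<Longrightarrow> min (fst x) (snd x) \<le> min (fst q) (snd q)"
    using continuous_attains_sup[OF \<open>compact H\<close> \<open>H \<noteq> {}\<close>] by blast
  define V where "V = min (fst q) (snd q)"
  obtain p where p: "\<And>i. i \<in> I \<Longrightarrow> 0 \<le> p i" "sum p I = 1"
    "fst q = (\<Sum>i\<in>I. p i * a i)" "snd q = (\<Sum>i\<in>I. p i * b i)"
    using q(1) \<open>H \<subseteq> W\<close> by (fastforce simp: W_def)
  define U where "U = {V<..} \<times> {V<..}"
  have "convex U" "U \<noteq> {}"
    by (auto simp: U_def intro!: convex_Times)
  moreover have "H \<inter> U = {}"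
    using q(2) by (force simp: U_def V_def)
  ultimately obtain c e where "c \<noteq> 0"
    and H: "\<And>x. x \<in> H \<Longrightarrow> inner c x \<le> e" and U: "\<And>x. x \<in> U \<Longrightarrow> e \<le> inner c x"
    using separating_hyperplane_sets[of H U] \<open>convex H\<close> \<open>H \<noteq> {}\<close> by metis
  obtain c1 c2 where c: "c = (c1, c2)" by (cases c)
  have U': "e \<le> c1 * (V + x) + c2 * (V + y)" if "x > 0" "y > 0" for x y
    using U[of "(V + x, V + y)"] that by (simp add: U_def c)
  \<comment> \<open>A linear function bounded below on the positive half-line cannot have negative
    slope. It is applied with one coordinate of a point of \<open>U\<close> growing and the other
    kept at \<open>V + 1\<close>.\<close>
  have nonneg: "0 \<le> k" if *: "\<And>x. x > 0 \<Longrightarrow> r \<le> k * x" for r k :: real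
  proof (rule ccontr)
    assume "\<not> 0 \<le> k"
    then have "k * ((\<bar>r\<bar> + 1) / (- k)) = - \<bar>r\<bar> - 1" "0 < (\<bar>r\<bar> + 1) / (- k)"
      by (auto simp: field_simps)
    then show False using *[of "(\<bar>r\<bar> + 1) / (- k)"] by linarith
  qed
  have "0 \<le> c1"
    by (rule nonneg[of "e - c1 * V - c2 * (V + 1)"]) (use U'[of _ 1] in \<open>simp add: algebra_simps\<close>)
  moreover have "0 \<le> c2"
    by (rule nonneg[of "e - c2 * V - c1 * (V + 1)"]) (use U'[of 1] in \<open>simp add: algebra_simps\<close>)
  ultimately have pos: "c1 + c2 > 0"
    using \<open>c \<noteq> 0\<close> by (auto simp: c zero_prod_def)
  \<comment> \<open>Points on the diagonal of \<open>U\<close> approach the corner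
    \<open>(V, V)\<close>, which carries the separation over to the corner itself.\<close>
  have "e \<le> (c1 + c2) * V + z" if "z > 0" for z
  proof -
    have "e \<le> (c1 + c2) * (V + z / (c1 + c2))"
      using U'[of "z / (c1 + c2)" "z / (c1 + c2)"] that pos by (simp add: distrib_right)
    then show ?thesis using pos by (simp add: distrib_left)
  qed
  then have e: "e \<le> (c1 + c2) * V"
    by (rule field_le_epsilon)
  show thesis
  proof (rule that[OF p(1,2), where w="c1 / (c1 + c2)" and V=V])
    fix i assume "i \<in> I"
    then have "(a i, b i) \<in> H" by (auto simp: H_def hull_inc)
    then have "c1 * a i + c2 * b i \<le> (c1 + c2) * V"
      using H e by (fastforce simp: c)
    then have "(c1 * a i + c2 * b i) / (c1 + c2) \<le> V"
      using pos by (simp add: divide_le_eq mult.commute)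
    moreover have "1 - c1 / (c1 + c2) = c2 / (c1 + c2)" using pos by (simp add: field_simps)
    ultimately show "c1 / (c1 + c2) * a i + (1 - c1 / (c1 + c2)) * b i \<le> V"
      by (simp add: add_divide_distrib)
  qed (use p(3,4) pos \<open>0 \<le> c1\<close> \<open>0 \<le> c2\<close> in \<open>auto simp: V_def\<close>)
qed

text \<open>If \<open>h \<le> x\<close>, monotonicity suffices. Otherwise \<open>y\<close> may be
  lowered to \<open>h - x\<close>; then \<open>x\<close> and \<open>h - x\<close> are complementary
  convex combinations of \<open>0\<close> and \<open>h\<close>, and the two chord bounds add up to
  \<open>G 0 + G h\<close>. It will be used with the distances from one point to the two
  sites.\<close>

lemma convex_on_add_le_boundary:
  fixes G :: "real \<Rightarrow> real"
  assumes conv: "convex_on {0..} G" and anti: "antimono_on {0..} G"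
    and "0 \<le> x" "0 \<le> y" "0 \<le> h" "h \<le> x + y"
  shows "G x + G y \<le> G 0 + G h"
proof -
  have G: "G v \<le> G u" if "0 \<le> u" "u \<le> v" for u v
    using anti that by (auto simp: monotone_on_def)
  show ?thesis
  proof (cases "h \<le> x")
    case True
    then show ?thesis using G[of h x] G[of 0 y] assms by simp
  next
    case False
    define t where "t = x / h"
    have h: "0 < h" using False assms by simp
    have t: "0 \<le> t" "t \<le> 1" using False assms h by (auto simp: t_def)
    have *: "G ((1 - s) *\<^sub>R 0 + s *\<^sub>R h) \<le> (1 - s) * G 0 + s * G h" if "0 \<le> s" "s \<le> 1" for s
      using convex_onD[OF conv that, of 0 h] h by simp
    have "G x \<le> (1 - t) * G 0 + t * G h" using *[of t] t h by (simp add: t_def)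
    moreover have "G y \<le> G (h - x)" using False assms by (intro G) auto
    moreover have "h - x = (1 - t) * h" using h by (simp add: t_def field_simps)
    then have "G (h - x) \<le> t * G 0 + (1 - t) * G h" using *[of "1 - t"] t by simp
    ultimately show ?thesis by (simp add: algebra_simps)
  qed
qed

subsection \<open>Exponential tails and logarithmic rates\<close>

text \<open>The ratio \<open>g (x - 1) / g x\<close> tends to \<open>exp \<beta>\<close>, so
  \<open>g x * exp (\<theta> * x)\<close> eventually grows under unit steps if
  \<open>\<theta> > \<beta>\<close> and shrinks if \<open>\<theta> < \<beta>\<close>. A bound on a
  compact interval then extends to the half-line; on that interval monotonicity of \<open>g\<close>
  replaces continuity.\<close>

lemma exp_tail_class_bounds:
  assumes g: "g \<in> exp_tail_class \<beta>" and anti: "antimono g"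
  shows exp_tail_class_lower: "\<And>\<theta>. \<beta> < \<theta> \<Longrightarrow> \<exists>k>0. \<forall>x\<ge>0. k * exp (- \<theta> * x) \<le> g x"
    and exp_tail_class_upper: "\<And>\<theta>. \<theta> < \<beta> \<Longrightarrow> \<exists>K>0. \<forall>x\<ge>0. g x \<le> K * exp (- \<theta> * x)"
proof -
  have nonneg: "0 \<le> g x" for x using g by (auto simp: exp_tail_class_def)
  have lim: "((\<lambda>x. g (x - t) / g x) \<longlongrightarrow> exp (t * \<beta>)) at_top" for t
    using g by (auto simp: exp_tail_class_def)
  \<comment> \<open>The case \<open>t = 0\<close> of the limit, with \<open>y / 0 = 0\<close>, makes
    \<open>g\<close> nonzero far out; monotonicity carries positivity back to every point.\<close>
  have "eventually (\<lambda>x. g x / g x > 0) at_top"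
    using lim[of 0] by (intro order_tendstoD(1)) auto
  then obtain N where N: "\<And>x. x \<ge> N \<Longrightarrow> g x / g x > 0"
    by (auto simp: eventually_at_top_linorder)
  have pos: "0 < g x" for x
  proof -
    have "g (max x N) \<noteq> 0" using N[of "max x N"] by auto
    moreover have "g (max x N) \<le> g x" using anti by (auto simp: antimono_def)
    ultimately show ?thesis using nonneg[of "max x N"] by linarith
  qed
  define f where "f \<theta> x = g x * exp (\<theta> * x)" for \<theta> x
  have step: "f \<theta> (x - 1) = g (x - 1) / g x * exp (- \<theta>) * f \<theta> x" for \<theta> x
    using pos[of x] by (simp add: f_def field_simps flip: exp_add)
  \<comment> \<open>Whole unit steps back from \<open>z\<close> end in a window of length one, where
    the bounds on \<open>[0, y + 1]\<close> apply.\<close>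
  have shift: "\<exists>n::nat. z - real n \<in> {y..y+1}" if "y \<le> z" for y z :: real
    using that by (intro exI[of _ "nat \<lfloor>z - y\<rfloor>"]) (auto, linarith+)

  show "\<exists>k>0. \<forall>x\<ge>0. k * exp (- \<theta> * x) \<le> g x" if "\<beta> < \<theta>" for \<theta>
  proof -
    have "eventually (\<lambda>x. g (x - 1) / g x < exp \<theta>) at_top"
      using lim[of 1] that by (intro order_tendstoD(2)) auto
    then obtain N where N: "\<And>x. x \<ge> N \<Longrightarrow> g (x - 1) / g x < exp \<theta>"
      by (auto simp: eventually_at_top_linorder)
    define y where "y = max N 0"
    have mono: "f \<theta> (x - 1) \<le> f \<theta> x" if "x \<ge> y" for x
    proof -
      have "g (x - 1) / g x * exp (- \<theta>) \<le> exp \<theta> * exp (- \<theta>)"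
        using N[of x] that by (intro mult_right_mono) (auto simp: y_def)
      also have "\<dots> = 1" by (simp flip: exp_add)
      finally have "g (x - 1) / g x * exp (- \<theta>) * f \<theta> x \<le> 1 * f \<theta> x"
        using pos[of x] by (intro mult_right_mono) (auto simp: f_def)
      then show ?thesis unfolding step[of \<theta> x] by simp
    qed
    have iter: "f \<theta> (x - real n) \<le> f \<theta> x" if "x - real n \<ge> y" for n x
      using that
    proof (induction n)
      case (Suc n)
      then have "f \<theta> (x - real n - 1) \<le> f \<theta> (x - real n)" by (intro mono) auto
      then show ?case using Suc by (simp add: algebra_simps)
    qed simp
    have \<theta>0: "exp (- \<bar>\<theta>\<bar> * (y + 1)) \<le> exp (\<theta> * z)" if "0 \<le> z" "z \<le> y + 1" for z
    proof -
      have "- (\<bar>\<theta>\<bar> * (y + 1)) \<le> - (\<bar>\<theta>\<bar> * z)" using that by (simp add: mult_left_mono)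
      also have "\<dots> \<le> \<theta> * z" using that by (cases "\<theta> \<ge> 0") auto
      finally show ?thesis by simp
    qed
    \<comment> \<open>On \<open>[0, y + 1]\<close> the factor \<open>g\<close> is smallest at the
      right end; the absolute value covers both signs of \<open>\<theta>\<close>.\<close>
    define k where "k = g (y + 1) * exp (- \<bar>\<theta>\<bar> * (y + 1))"
    have low: "k \<le> f \<theta> z" if "0 \<le> z" "z \<le> y + 1" for z
      unfolding k_def f_def using that nonneg \<theta>0[OF that] anti
      by (intro mult_mono) (auto simp: antimono_def)
    have "k \<le> f \<theta> z" if "0 \<le> z" for z
    proof (cases "z \<le> y")
      case False
      then obtain n :: nat where "z - real n \<in> {y..y+1}" using shift[of y z] by auto
      then show ?thesis using low[of "z - real n"] iter[of z n] by (auto simp: y_def)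
    qed (use low that in auto)
    moreover have "k > 0" using pos by (simp add: k_def)
    ultimately show ?thesis
      by (intro exI[of _ k]) (auto simp: f_def exp_minus field_simps)
  qed

  show "\<exists>K>0. \<forall>x\<ge>0. g x \<le> K * exp (- \<theta> * x)" if "\<theta> < \<beta>" for \<theta>
  proof -
    have "eventually (\<lambda>x. exp \<theta> < g (x - 1) / g x) at_top"
      using lim[of 1] that by (intro order_tendstoD(1)) auto
    then obtain N where N: "\<And>x. x \<ge> N \<Longrightarrow> exp \<theta> < g (x - 1) / g x"
      by (auto simp: eventually_at_top_linorder)
    define y where "y = max N 0"
    have mono: "f \<theta> x \<le> f \<theta> (x - 1)" if "x \<ge> y" for x
    proof -
      have "1 = exp \<theta> * exp (- \<theta>)" by (simp flip: exp_add)
      also have "\<dots> \<le> g (x - 1) / g x * exp (- \<theta>)"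
        using N[of x] that by (intro mult_right_mono) (auto simp: y_def)
      finally have "1 * f \<theta> x \<le> g (x - 1) / g x * exp (- \<theta>) * f \<theta> x"
        using pos[of x] by (intro mult_right_mono) (auto simp: f_def)
      then show ?thesis unfolding step[of \<theta> x] by simp
    qed
    have iter: "f \<theta> x \<le> f \<theta> (x - real n)" if "x - real n \<ge> y" for n x
      using that
    proof (induction n)
      case (Suc n)
      then have "f \<theta> (x - real n) \<le> f \<theta> (x - real n - 1)" by (intro mono) auto
      then show ?case using Suc by (simp add: algebra_simps)
    qed simp
    have \<theta>0: "exp (\<theta> * z) \<le> exp (\<bar>\<theta>\<bar> * (y + 1))" if "0 \<le> z" "z \<le> y + 1" for z
    proof -
      have "\<theta> * z \<le> \<bar>\<theta>\<bar> * z" using that by (simp add: mult_right_mono)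
      also have "\<dots> \<le> \<bar>\<theta>\<bar> * (y + 1)" using that by (simp add: mult_left_mono)
      finally show ?thesis by simp
    qed
    define K where "K = g 0 * exp (\<bar>\<theta>\<bar> * (y + 1))"
    have up: "f \<theta> z \<le> K" if "0 \<le> z" "z \<le> y + 1" for z
      unfolding K_def f_def using that nonneg \<theta>0[OF that] anti
      by (intro mult_mono) (auto simp: antimono_def)
    have "f \<theta> z \<le> K" if "0 \<le> z" for z
    proof (cases "z \<le> y")
      case False
      then obtain n :: nat where "z - real n \<in> {y..y+1}" using shift[of y z] by auto
      then show ?thesis using up[of "z - real n"] iter[of z n] by (auto simp: y_def)
    qed (use up that in auto)
    moreover have "K > 0" using pos by (simp add: K_def)
    ultimately show ?thesis
      by (intro exI[of _ K]) (auto simp: f_def exp_minus field_simps)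
  qed
qed

text \<open>The constants \<open>K\<close> and \<open>k\<close> may depend on \<open>r\<close>:
  their logarithms vanish after division by \<open>t\<close>, and \<open>r\<close> can be taken
  arbitrarily close to \<open>c\<close>.\<close>

lemma tendsto_ln_over_id:
  fixes f :: "real \<Rightarrow> real"
  assumes up: "\<And>r. r < c \<Longrightarrow> \<exists>K>0. \<forall>t\<ge>0. f t \<le> K * exp (- r * t)"
    and low: "\<And>r. c < r \<Longrightarrow> \<exists>k>0. \<forall>t\<ge>0. k * exp (- r * t) \<le> f t"
  shows "((\<lambda>t. ln (f t) / t) \<longlongrightarrow> - c) at_top"
proof -
  have pos: "f t > 0" if "t \<ge> 0" for t
  proof -
    obtain k where "k > 0" "k * exp (- (c + 1) * t) \<le> f t" using low[of "c + 1"] \<open>t \<ge> 0\<close> by auto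
    moreover have "0 < k * exp (- (c + 1) * t)" using \<open>k > 0\<close> by simp
    ultimately show ?thesis by linarith
  qed
  have lim: "((\<lambda>t. ln k / t - r) \<longlongrightarrow> - r) at_top" for k r :: real
    by real_asymp
  show ?thesis
  proof (rule order_tendstoI)
    fix l assume "l < - c"
    then obtain r where r: "c < r" "l < - r" using dense[of l "-c"] by (metis add.inverse_inverse neg_less_iff_less)
    obtain k where k: "k > 0" "\<And>t. t \<ge> 0 \<Longrightarrow> k * exp (- r * t) \<le> f t" using low r(1) by blast
    have "\<forall>\<^sub>F t in at_top. l < ln k / t - r" using lim[of k r] r by (intro order_tendstoD) auto
    with eventually_gt_at_top[of 0] show "\<forall>\<^sub>F t in at_top. l < ln (f t) / t"
    proof eventually_elim
      case (elim t)
      have "ln k - r * t = ln (k * exp (- r * t))" using k by (simp add: ln_mult)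
      also have "\<dots> \<le> ln (f t)" using k elim pos[of t] by (subst ln_le_cancel_iff) auto
      finally have "(ln k - r * t) / t \<le> ln (f t) / t" using elim by (intro divide_right_mono) auto
      then have "ln k / t - r \<le> ln (f t) / t" using elim by (simp add: diff_divide_distrib)
      then show ?case using elim by linarith
    qed
  next
    fix u assume "- c < u"
    then obtain r where r: "r < c" "- r < u" using dense[of "-c" u] by (metis add.inverse_inverse neg_less_iff_less)
    obtain k where k: "k > 0" "\<And>t. t \<ge> 0 \<Longrightarrow> f t \<le> k * exp (- r * t)" using up r(1) by blast
    have "\<forall>\<^sub>F t in at_top. ln k / t - r < u" using lim[of k r] r by (intro order_tendstoD) auto
    with eventually_gt_at_top[of 0] show "\<forall>\<^sub>F t in at_top. ln (f t) / t < u"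
    proof eventually_elim
      case (elim t)
      have "ln (f t) \<le> ln (k * exp (- r * t))" using k elim pos[of t] by (subst ln_le_cancel_iff) auto
      also have "\<dots> = ln k - r * t" using k by (simp add: ln_mult)
      finally have "ln (f t) / t \<le> (ln k - r * t) / t" using elim by (intro divide_right_mono) auto
      then have "ln (f t) / t \<le> ln k / t - r" using elim by (simp add: diff_divide_distrib)
      then show ?case using elim by linarith
    qed
  qed
qed

subsection \<open>Tail rates of weighted sums\<close>

context prob_space
begin

lemma one_minus_distr_fun:
  assumes [measurable]: "X \<in> borel_measurable M"
  shows "1 - distr_fun M X x = prob {\<omega> \<in> space M. x < X \<omega>}"
proof -
  have "distr_fun M X x = prob {\<omega> \<in> space M. X \<omega> \<le> x}"
    by (auto simp: distr_fun_def cdf_def measure_distr vimage_def Int_def intro!: arg_cong[where f=prob])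
  also have "\<dots> = 1 - prob {\<omega> \<in> space M. x < X \<omega>}"
    by (subst prob_compl[symmetric]) (auto intro!: arg_cong[where f=prob])
  finally show ?thesis by simp
qed

lemma distr_fun_mono:
  assumes [measurable]: "X \<in> borel_measurable M" and "x \<le> y"
  shows "distr_fun M X x \<le> distr_fun M X y"
proof -
  have "prob {\<omega> \<in> space M. y < X \<omega>} \<le> prob {\<omega> \<in> space M. x < X \<omega>}"
    using \<open>x \<le> y\<close> by (intro finite_measure_mono) auto
  then show ?thesis
    using one_minus_distr_fun[of X x] one_minus_distr_fun[of X y] by simp
qed

text \<open>Cutting at the integers bounds the positive part by a sum of
  \<open>exp (\<theta> * (n + 1))\<close> times the probability of \<open>X > n\<close>, which is
  dominated by a geometric series for \<open>r\<close> between \<open>\<theta>\<close> and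
  \<open>\<beta>\<close>. Nothing is known about the left tail, but as
  \<open>\<theta> \<ge> 0\<close> it contributes at most 1.\<close>

lemma nn_integral_exp_finite:
  assumes [measurable]: "X \<in> borel_measurable M" and "0 \<le> \<theta>" "\<theta> < \<beta>"
    and tail: "\<And>r. r < \<beta> \<Longrightarrow> \<exists>K>0. \<forall>x\<ge>0. prob {\<omega> \<in> space M. x < X \<omega>} \<le> K * exp (- r * x)"
  shows "(\<integral>\<^sup>+\<omega>. ennreal (exp (\<theta> * X \<omega>)) \<partial>M) < \<infinity>"
proof -
  obtain r where r: "\<theta> < r" "r < \<beta>" using \<open>\<theta> < \<beta>\<close> dense by blast
  obtain K where K: "0 < K" "\<And>x. 0 \<le> x \<Longrightarrow> prob {\<omega> \<in> space M. x < X \<omega>} \<le> K * exp (- r * x)"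
    using tail[OF r(2)] by blast
  define A where "A n = {\<omega> \<in> space M. real n < X \<omega>}" for n
  have A[measurable]: "A n \<in> events" for n by (simp add: A_def)
  have "(\<integral>\<^sup>+\<omega>. ennreal (exp (\<theta> * X \<omega>)) \<partial>M) \<le>
      (\<integral>\<^sup>+\<omega>. 1 + (\<Sum>n. ennreal (exp (\<theta> * (real n + 1))) * indicator (A n) \<omega>) \<partial>M)"
  proof (rule nn_integral_mono)
    fix \<omega> assume \<omega>: "\<omega> \<in> space M"
    show "ennreal (exp (\<theta> * X \<omega>)) \<le> 1 + (\<Sum>n. ennreal (exp (\<theta> * (real n + 1))) * indicator (A n) \<omega>)"
    proof (cases "X \<omega> \<le> 0")
      case True
      then have "exp (\<theta> * X \<omega>) \<le> 1" using \<open>0 \<le> \<theta>\<close> by (simp add: mult_nonneg_nonpos)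
      then have "ennreal (exp (\<theta> * X \<omega>)) \<le> 1" by (simp flip: ennreal_1)
      then show ?thesis by (simp add: add_increasing2)
    next
      case False
      \<comment> \<open>The ceiling minus one, and not the floor, because \<open>A m\<close> demands
        the strict inequality \<open>m < X \<omega>\<close>.\<close>
      define m where "m = nat (\<lceil>X \<omega>\<rceil> - 1)"
      have m: "real m < X \<omega>" "X \<omega> \<le> real m + 1"
        using False unfolding m_def by linarith+
      have "ennreal (exp (\<theta> * X \<omega>)) \<le> ennreal (exp (\<theta> * (real m + 1))) * indicator (A m) \<omega>"
        using m \<omega> \<open>0 \<le> \<theta>\<close> by (auto simp: A_def intro!: ennreal_leI mult_left_mono)
      also have "\<dots> = (\<Sum>n\<in>{m}. ennreal (exp (\<theta> * (real n + 1))) * indicator (A n) \<omega>)"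
        by (simp only: sum.insert[OF finite.emptyI] empty_iff not_False_eq_True sum.empty add_0_right)
      also have "\<dots> \<le> (\<Sum>n. ennreal (exp (\<theta> * (real n + 1))) * indicator (A n) \<omega>)"
        by (rule sum_le_suminf) auto
      finally show ?thesis by (simp add: add_increasing)
    qed
  qed
  also have "\<dots> = 1 + (\<Sum>n. ennreal (exp (\<theta> * (real n + 1))) * emeasure M (A n))"
    by (subst nn_integral_add) (auto simp: nn_integral_suminf nn_integral_cmult emeasure_space_1)
  also have "\<dots> \<le> 1 + (\<Sum>n. ennreal (K * exp \<theta> * exp (\<theta> - r) ^ n))"
  proof (intro add_left_mono suminf_le)
    fix n
    have "exp (\<theta> * (real n + 1)) * prob (A n) \<le> exp (\<theta> * (real n + 1)) * (K * exp (- r * real n))"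
      using K(2)[of "real n"] by (intro mult_left_mono) (auto simp: A_def)
    also have "\<dots> = K * exp \<theta> * exp (\<theta> - r) ^ n"
      by (simp add: algebra_simps flip: exp_add exp_of_nat_mult)
    finally show "ennreal (exp (\<theta> * (real n + 1))) * emeasure M (A n) \<le> ennreal (K * exp \<theta> * exp (\<theta> - r) ^ n)"
      by (simp add: emeasure_eq_measure ennreal_leI flip: ennreal_mult)
  qed auto
  also have "\<dots> < \<infinity>"
  proof -
    have "summable (\<lambda>n. K * exp \<theta> * exp (\<theta> - r) ^ n)"
      using r by (intro summable_mult summable_geometric) auto
    then have "(\<Sum>n. ennreal (K * exp \<theta> * exp (\<theta> - r) ^ n)) \<noteq> \<top>"
      using K(1) by (intro ennreal_suminf_neq_top) auto
    then show ?thesis by (simp add: less_top[symmetric])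
  qed
  finally show ?thesis .
qed

text \<open>A Chernoff bound: by independence the exponential moment of the sum factorises, and each
  factor is finite because \<open>c i < \<beta>\<close>. The Chernoff parameter is absorbed into the
  coefficients \<open>c i\<close>.\<close>

lemma indep_sum_tail_upper:
  fixes Z :: "'i \<Rightarrow> 'a \<Rightarrow> real"
  assumes I: "finite I" "indep_vars (\<lambda>_. borel) Z I"
    and tail: "\<And>i r. i \<in> I \<Longrightarrow> r < \<beta> \<Longrightarrow>
      \<exists>K>0. \<forall>x\<ge>0. prob {\<omega> \<in> space M. x < Z i \<omega>} \<le> K * exp (- r * x)"
    and c: "\<And>i. i \<in> I \<Longrightarrow> 0 \<le> c i \<and> c i < \<beta>"
  shows "\<exists>K>0. \<forall>x. prob {\<omega> \<in> space M. x \<le> (\<Sum>i\<in>I. c i * Z i \<omega>)} \<le> K * exp (- x)"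
proof -
  have Z[measurable]: "Z i \<in> borel_measurable M" if "i \<in> I" for i
    using I(2) that by (auto simp: indep_vars_def)
  define W where "W \<omega> = (\<Sum>i\<in>I. c i * Z i \<omega>)" for \<omega>
  have [measurable]: "W \<in> borel_measurable M" unfolding W_def by measurable
  define E where "E = (\<integral>\<^sup>+\<omega>. ennreal (exp (W \<omega>)) \<partial>M)"
  have "E = (\<integral>\<^sup>+\<omega>. (\<Prod>i\<in>I. ennreal (exp (c i * Z i \<omega>))) \<partial>M)"
    using I(1) by (simp add: E_def W_def exp_sum prod_ennreal)
  also have "\<dots> = (\<Prod>i\<in>I. \<integral>\<^sup>+\<omega>. ennreal (exp (c i * Z i \<omega>)) \<partial>M)"
    using I by (intro indep_vars_nn_integral indep_vars_compose2[OF I(2)]) auto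
  also have "\<dots> < \<infinity>"
  proof -
    have "(\<integral>\<^sup>+\<omega>. ennreal (exp (c i * Z i \<omega>)) \<partial>M) \<noteq> \<top>" if "i \<in> I" for i
      using nn_integral_exp_finite[of "Z i" "c i" \<beta>] tail c that by (auto simp: less_top[symmetric])
    then have "(\<Prod>i\<in>I. \<integral>\<^sup>+\<omega>. ennreal (exp (c i * Z i \<omega>)) \<partial>M) \<noteq> \<top>"
      by (simp add: ennreal_prod_eq_top)
    then show ?thesis unfolding infinity_ennreal_def by (simp only: less_top)
  qed
  finally have "E < \<infinity>" .
  show ?thesis
  \<comment> \<open>The added 1 makes the constant positive at once.\<close>
  proof (intro exI[of _ "enn2real E + 1"] conjI allI)
    show "0 < enn2real E + 1" by (simp add: add_nonneg_pos)
    fix x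
    have "emeasure M {\<omega> \<in> space M. x \<le> W \<omega>} = emeasure M {\<omega> \<in> space M. 1 \<le> ennreal (exp (- x)) * ennreal (exp (W \<omega>))}"
      by (intro arg_cong[where f="emeasure M"]) (auto simp flip: ennreal_mult exp_add ennreal_1)
    also have "\<dots> \<le> ennreal (exp (- x)) * (\<integral>\<^sup>+\<omega>. ennreal (exp (W \<omega>)) * indicator (space M) \<omega> \<partial>M)"
      by (intro nn_integral_Markov_inequality) auto
    also have "\<dots> = ennreal (exp (- x)) * E"
      unfolding E_def by (intro arg_cong[where f="\<lambda>x. _ * x"] nn_integral_cong) auto
    also have "E = ennreal (enn2real E)" using \<open>E < \<infinity>\<close> by simp
    finally have "prob {\<omega> \<in> space M. x \<le> W \<omega>} \<le> exp (- x) * enn2real E"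
      by (simp add: emeasure_eq_measure flip: ennreal_mult)
    also have "\<dots> \<le> (enn2real E + 1) * exp (- x)" by (simp add: algebra_simps)
    finally show "prob {\<omega> \<in> space M. x \<le> (\<Sum>i\<in>I. c i * Z i \<omega>)} \<le> (enn2real E + 1) * exp (- x)"
      by (simp add: W_def)
  qed
qed

text \<open>Independence turns the joint event into a product, so that the costs
  \<open>\<theta> * z i\<close> add up. Such an event will lie inside the joint exceedance of both
  sums when \<open>z\<close> is a feasible point of the linear program.\<close>

lemma indep_joint_tail_lower:
  fixes Z :: "'i \<Rightarrow> 'a \<Rightarrow> real"
  assumes I: "finite I" "I \<noteq> {}" "indep_vars (\<lambda>_. borel) Z I"
    and tail: "\<And>i. i \<in> I \<Longrightarrow> \<exists>k>0. \<forall>x\<ge>0. k * exp (- \<theta> * x) \<le> prob {\<omega> \<in> space M. x < Z i \<omega>}"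
    and z: "\<And>i. i \<in> I \<Longrightarrow> 0 \<le> z i"
  shows "\<exists>k>0. \<forall>t\<ge>0.
    k * exp (- (\<theta> * sum z I) * t) \<le> prob {\<omega> \<in> space M. \<forall>i\<in>I. t * z i < Z i \<omega>}"
proof -
  obtain k where k: "\<And>i. i \<in> I \<Longrightarrow> 0 < k i"
    "\<And>i x. i \<in> I \<Longrightarrow> 0 \<le> x \<Longrightarrow> k i * exp (- \<theta> * x) \<le> prob {\<omega> \<in> space M. x < Z i \<omega>}"
    using tail by metis
  show ?thesis
  proof (intro exI[of _ "prod k I"] conjI allI impI)
    show "0 < prod k I" using k by (intro prod_pos) auto
    fix t :: real assume "0 \<le> t"
    have "prod k I * exp (- (\<theta> * sum z I) * t) = (\<Prod>i\<in>I. k i * exp (- \<theta> * (t * z i)))"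
      using I(1) by (simp add: prod.distrib sum_distrib_left sum_distrib_right ac_simps
          flip: exp_sum sum_negf)
    also have "\<dots> \<le> (\<Prod>i\<in>I. prob {\<omega> \<in> space M. t * z i < Z i \<omega>})"
      using k z \<open>0 \<le> t\<close> by (intro prod_mono) (auto intro!: mult_nonneg_nonneg less_imp_le)
    also have "\<dots> = (\<Prod>i\<in>I. prob (Z i -` {t * z i<..} \<inter> space M))"
      by (intro prod.cong refl arg_cong[where f=prob]) auto
    also have "\<dots> = prob (\<Inter>i\<in>I. Z i -` {t * z i<..} \<inter> space M)"
      using I by (intro indep_varsD_finite[symmetric]) auto
    also have "(\<Inter>i\<in>I. Z i -` {t * z i<..} \<inter> space M) = {\<omega> \<in> space M. \<forall>i\<in>I. t * z i < Z i \<omega>}"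
      using I by auto
    finally show "prod k I * exp (- (\<theta> * sum z I) * t) \<le> prob {\<omega> \<in> space M. \<forall>i\<in>I. t * z i < Z i \<omega>}" .
  qed
qed

text \<open>The strategies of the game act as certificates: \<open>w\<close> yields the Chernoff
  upper bound, \<open>p\<close> the independent exceedances for the lower bound, and the common
  value \<open>V\<close> makes the two rates agree.\<close>

lemma indep_sums_joint_tail_rate:
  fixes Z :: "'i \<Rightarrow> 'a \<Rightarrow> real"
  assumes I: "finite I" "I \<noteq> {}" "indep_vars (\<lambda>_. borel) Z I" and "0 < \<beta>"
    and tail: "\<And>i. i \<in> I \<Longrightarrow> (\<lambda>x. 1 - distr_fun M (Z i) x) \<in> exp_tail_class \<beta>"
    and ab: "\<And>i. i \<in> I \<Longrightarrow> 0 < a i" "\<And>i. i \<in> I \<Longrightarrow> 0 < b i" and AB: "0 < A" "0 < B" and "0 < V"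
    and p: "\<And>i. i \<in> I \<Longrightarrow> 0 \<le> p i" "sum p I = 1"
      "V \<le> (\<Sum>i\<in>I. p i * (a i / A))" "V \<le> (\<Sum>i\<in>I. p i * (b i / B))"
    and w: "0 \<le> w" "w \<le> 1" "\<And>i. i \<in> I \<Longrightarrow> w * (a i / A) + (1 - w) * (b i / B) \<le> V"
  shows "((\<lambda>t. ln (prob {\<omega> \<in> space M. t * (A / \<beta>) < (\<Sum>i\<in>I. a i * Z i \<omega>) \<and>
            t * (B / \<beta>) < (\<Sum>i\<in>I. b i * Z i \<omega>)}) / t) \<longlongrightarrow> - (1 / V)) at_top"
proof (rule tendsto_ln_over_id)
  have Z[measurable]: "Z i \<in> borel_measurable M" if "i \<in> I" for i
    using I(3) that by (auto simp: indep_vars_def)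
  have anti: "antimono (\<lambda>x. 1 - distr_fun M (Z i) x)" if "i \<in> I" for i
    using distr_fun_mono[OF Z[OF that]] by (auto simp: antimono_def)
  have lower: "\<exists>k>0. \<forall>x\<ge>0. k * exp (- \<theta> * x) \<le> prob {\<omega> \<in> space M. x < Z i \<omega>}"
    if "i \<in> I" "\<beta> < \<theta>" for i \<theta>
    using exp_tail_class_lower[OF tail anti that(2)] that(1) by (simp add: one_minus_distr_fun)
  have upper: "\<exists>K>0. \<forall>x\<ge>0. prob {\<omega> \<in> space M. x < Z i \<omega>} \<le> K * exp (- \<theta> * x)"
    if "i \<in> I" "\<theta> < \<beta>" for i \<theta>
    using exp_tail_class_upper[OF tail anti that(2)] that(1) by (simp add: one_minus_distr_fun)
  define X where "X \<omega> = (\<Sum>i\<in>I. a i * Z i \<omega>)" for \<omega>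
  define Y where "Y \<omega> = (\<Sum>i\<in>I. b i * Z i \<omega>)" for \<omega>
  have [measurable]: "X \<in> borel_measurable M" "Y \<in> borel_measurable M"
    unfolding X_def Y_def by measurable
  define Q where "Q t = {\<omega> \<in> space M. t * (A / \<beta>) < X \<omega> \<and> t * (B / \<beta>) < Y \<omega>}" for t
  have [measurable]: "Q t \<in> events" for t unfolding Q_def by measurable
  have Q: "Q t = {\<omega> \<in> space M. t * (A / \<beta>) < (\<Sum>i\<in>I. a i * Z i \<omega>) \<and>
      t * (B / \<beta>) < (\<Sum>i\<in>I. b i * Z i \<omega>)}" for t
    by (simp add: Q_def X_def Y_def)

  show "\<exists>K>0. \<forall>t\<ge>0. prob {\<omega> \<in> space M. t * (A / \<beta>) < (\<Sum>i\<in>I. a i * Z i \<omega>) \<and>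
      t * (B / \<beta>) < (\<Sum>i\<in>I. b i * Z i \<omega>)} \<le> K * exp (- r * t)" if r: "r < 1 / V" for r
  \<comment> \<open>For \<open>r \<le> 0\<close> the claimed bound is at least 1; the Chernoff
    argument needs nonnegative coefficients.\<close>
  proof (cases "0 < r")
    case False
    then have "prob (Q t) \<le> 1 * exp (- r * t)" if "0 \<le> t" for t
      using that by (intro order_trans[OF prob_le_1]) (auto simp: mult_nonpos_nonneg)
    then show ?thesis unfolding Q by (intro exI[of _ 1]) auto
  next
    case True
    \<comment> \<open>The coefficients of \<open>w / A * X + (1 - w) / B * Y\<close>, scaled so that
      the combination is at least \<open>r * t\<close> on \<open>Q t\<close>. The condition on
      \<open>w\<close> gives \<open>c i \<le> r * V * \<beta>\<close>, which is below
      \<open>\<beta>\<close> exactly because \<open>r < 1 / V\<close>.\<close>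
    define c where "c i = r * \<beta> * (w * (a i / A) + (1 - w) * (b i / B))" for i
    have c: "0 \<le> c i \<and> c i < \<beta>" if i: "i \<in> I" for i
    proof
      show "0 \<le> c i" using True \<open>0 < \<beta>\<close> AB w ab[OF i] by (simp add: c_def)
      have "c i \<le> r * \<beta> * V"
        unfolding c_def using True \<open>0 < \<beta>\<close> w(3)[OF i] by (intro mult_left_mono) auto
      also have "\<dots> = (r * V) * \<beta>" by simp
      also have "\<dots> < 1 * \<beta>"
        using r \<open>0 < V\<close> \<open>0 < \<beta>\<close> by (intro mult_strict_right_mono) (auto simp: field_simps)
      finally show "c i < \<beta>" by simp
    qed
    obtain K where K: "K > 0" "\<And>x. prob {\<omega> \<in> space M. x \<le> (\<Sum>i\<in>I. c i * Z i \<omega>)} \<le> K * exp (- x)"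
      using indep_sum_tail_upper[of I Z \<beta> c, OF I(1,3)] upper c by auto
    have comb: "(\<Sum>i\<in>I. c i * Z i \<omega>) = r * \<beta> * (w / A * X \<omega> + (1 - w) / B * Y \<omega>)" for \<omega>
      by (simp add: X_def Y_def c_def sum_distrib_left algebra_simps flip: sum.distrib)
    have "prob (Q t) \<le> K * exp (- r * t)" if "0 \<le> t" for t
    proof -
      have "prob (Q t) \<le> prob {\<omega> \<in> space M. r * t \<le> (\<Sum>i\<in>I. c i * Z i \<omega>)}"
      proof (rule finite_measure_mono)
        show "Q t \<subseteq> {\<omega> \<in> space M. r * t \<le> (\<Sum>i\<in>I. c i * Z i \<omega>)}"
        proof
          fix \<omega> assume \<omega>: "\<omega> \<in> Q t"
          have "r * t = r * \<beta> * (w / A * (t * (A / \<beta>)) + (1 - w) / B * (t * (B / \<beta>)))"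
            using AB \<open>0 < \<beta>\<close> by (simp add: field_simps)
          also have "\<dots> \<le> r * \<beta> * (w / A * X \<omega> + (1 - w) / B * Y \<omega>)"
            using AB \<open>0 < \<beta>\<close> True w \<omega>
            by (intro mult_left_mono add_mono) (auto simp: Q_def)
          finally show "\<omega> \<in> {\<omega> \<in> space M. r * t \<le> (\<Sum>i\<in>I. c i * Z i \<omega>)}"
            using \<omega> by (simp add: comb Q_def)
        qed
      qed measurable
      also have "\<dots> \<le> K * exp (- (r * t))" by (rule K)
      finally show ?thesis by simp
    qed
    then show ?thesis unfolding Q using K(1) by blast
  qed

  show "\<exists>k>0. \<forall>t\<ge>0. k * exp (- r * t) \<le> prob {\<omega> \<in> space M. t * (A / \<beta>) < (\<Sum>i\<in>I. a i * Z i \<omega>) \<and>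
      t * (B / \<beta>) < (\<Sum>i\<in>I. b i * Z i \<omega>)}" if r: "1 / V < r" for r
  proof -
    \<comment> \<open>The primal solution: the levels sum to \<open>1 / (V * \<beta>)\<close>. With
      the admissible exponent \<open>\<theta> = r * V * \<beta> > \<beta>\<close> the total cost is
      therefore \<open>r\<close>.\<close>
    define z where "z i = p i / (V * \<beta>)" for i
    have z: "0 \<le> z i" if "i \<in> I" for i
      using p(1)[OF that] \<open>0 < V\<close> \<open>0 < \<beta>\<close> by (simp add: z_def)
    have "\<beta> < r * V * \<beta>" using r \<open>0 < V\<close> \<open>0 < \<beta>\<close> by (simp add: field_simps)
    then obtain k where k: "k > 0" "\<And>t. t \<ge> 0 \<Longrightarrow>
        k * exp (- (r * V * \<beta> * sum z I) * t) \<le> prob {\<omega> \<in> space M. \<forall>i\<in>I. t * z i < Z i \<omega>}"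
      using indep_joint_tail_lower[of I Z "r * V * \<beta>" z, OF I] lower z by auto
    have sum_z: "r * V * \<beta> * sum z I = r"
      using p(2) \<open>0 < V\<close> \<open>0 < \<beta>\<close> by (simp add: z_def flip: sum_divide_distrib)
    \<comment> \<open>Stated for arbitrary \<open>a\<close> and \<open>A\<close>, which shadow the
      fixed ones, so as to serve both sums.\<close>
    have exceed: "t * (A / \<beta>) < (\<Sum>i\<in>I. a i * Z i \<omega>)"
      if "0 \<le> t" "\<forall>i\<in>I. t * z i < Z i \<omega>" "\<And>i. i \<in> I \<Longrightarrow> 0 < a i" "0 < A"
        "V \<le> (\<Sum>i\<in>I. p i * (a i / A))" for t \<omega> A and a :: "'i \<Rightarrow> real"
    proof -
      have "t * (A / \<beta>) = t * (A / (V * \<beta>)) * V" using \<open>0 < V\<close> by simp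
      also have "\<dots> \<le> t * (A / (V * \<beta>)) * (\<Sum>i\<in>I. p i * (a i / A))"
        using that \<open>0 < V\<close> \<open>0 < \<beta>\<close> by (intro mult_left_mono) auto
      also have "\<dots> = (\<Sum>i\<in>I. a i * (t * z i))"
        using that by (simp add: z_def sum_distrib_left algebra_simps)
      also have "\<dots> < (\<Sum>i\<in>I. a i * Z i \<omega>)"
        using that I by (intro sum_strict_mono) auto
      finally show ?thesis .
    qed
    have "k * exp (- r * t) \<le> prob (Q t)" if "0 \<le> t" for t
    proof -
      have "k * exp (- r * t) \<le> prob {\<omega> \<in> space M. \<forall>i\<in>I. t * z i < Z i \<omega>}"
        using k(2)[OF that] by (simp add: sum_z)
      also have "\<dots> \<le> prob (Q t)"
        using exceed[of t _ a A] exceed[of t _ b B] that ab AB p(3,4)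
        by (intro finite_measure_mono) (auto simp: Q)
      finally show ?thesis .
    qed
    then show ?thesis unfolding Q using k(1) by blast
  qed
qed

text \<open>The distribution functions are never inverted. With \<open>L q = - ln (1 - q)\<close>,
  the marginal rates place the event \<open>q < distr_fun M X (X \<omega>)\<close> between
  exceedances of \<open>L q / c * \<alpha>\<close> for \<open>c\<close> slightly below and slightly
  above 1. Hence \<open>R q\<close> is squeezed between values of \<open>Q\<close> with almost the
  same logarithmic rate.\<close>

lemma has_residual_tail_dependenceI:
  assumes [measurable]: "X \<in> borel_measurable M" "Y \<in> borel_measurable M"
    and X: "((\<lambda>t. ln (prob {\<omega> \<in> space M. t * \<alpha> < X \<omega>}) / t) \<longlongrightarrow> - 1) at_top"
    and Y: "((\<lambda>t. ln (prob {\<omega> \<in> space M. t * \<gamma> < Y \<omega>}) / t) \<longlongrightarrow> - 1) at_top"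
    and XY: "((\<lambda>t. ln (prob {\<omega> \<in> space M. t * \<alpha> < X \<omega> \<and> t * \<gamma> < Y \<omega>}) / t) \<longlongrightarrow> - (1 / V)) at_top"
    and "0 < V"
  shows "has_residual_tail_dependence M X Y V"
proof -
  define Q where "Q t = prob {\<omega> \<in> space M. t * \<alpha> < X \<omega> \<and> t * \<gamma> < Y \<omega>}" for t
  define R where "R q = prob {\<omega> \<in> space M. q < distr_fun M X (X \<omega>) \<and> q < distr_fun M Y (Y \<omega>)}" for q
  define L where "L q = - ln (1 - q)" for q :: real
  have L: "filterlim L at_top (at_left 1)" unfolding L_def by real_asymp
  have Lc: "filterlim (\<lambda>q. L q / c) at_top (at_left 1)" if "c > 0" for c
    using filterlim_tendsto_pos_mult_at_top[OF tendsto_const[of "inverse c"] _ L] that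
    by (simp add: field_simps)
  have exp_L: "exp (- L q) = 1 - q" if "q < 1" for q using that by (simp add: L_def)
  have q1: "\<forall>\<^sub>F q in at_left (1::real). q < 1" by (simp add: eventually_at_filter)
  have [measurable]: "distr_fun M X \<in> borel_measurable borel" "distr_fun M Y \<in> borel_measurable borel"
    by (auto intro!: borel_measurable_mono monoI distr_fun_mono)
  have Q_lim: "((\<lambda>q. ln (Q (L q / c)) / L q) \<longlongrightarrow> - (1 / V) / c) (at_left 1)" if "c > 0" for c
  proof -
    have "((\<lambda>q. ln (Q (L q / c)) / (L q / c) / c) \<longlongrightarrow> - (1 / V) / c) (at_left 1)"
      using that by (intro tendsto_divide filterlim_compose[OF XY[folded Q_def] Lc] tendsto_const) auto
    then show ?thesis using that by simp
  qed
  \<comment> \<open>As \<open>ln 0 = 0\<close>, a strictly negative quotient excludes probability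
    zero; the marginal estimates below use the same device.\<close>
  have Q_pos: "\<forall>\<^sub>F t in at_top. 0 < Q t"
  proof -
    have "\<forall>\<^sub>F t in at_top. ln (Q t) / t < 0"
      using XY[folded Q_def] \<open>0 < V\<close> by (intro order_tendstoD) auto
    with eventually_gt_at_top[of 0] show ?thesis
    proof eventually_elim
      case (elim t)
      then have "Q t \<noteq> 0" by auto
      then show ?case by (simp add: Q_def less_le)
    qed
  qed
  have marginal_lower: "\<forall>\<^sub>F t in at_top. exp (- c * t) \<le> prob {\<omega> \<in> space M. t * \<alpha> < X \<omega>}"
    if X: "((\<lambda>t. ln (prob {\<omega> \<in> space M. t * \<alpha> < X \<omega>}) / t) \<longlongrightarrow> - 1) at_top" and "1 < c" for X \<alpha> c
  proof -
    have "\<forall>\<^sub>F t in at_top. - c < ln (prob {\<omega> \<in> space M. t * \<alpha> < X \<omega>}) / t"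
      "\<forall>\<^sub>F t in at_top. ln (prob {\<omega> \<in> space M. t * \<alpha> < X \<omega>}) / t < 0"
      using order_tendstoD[OF X] \<open>1 < c\<close> by auto
    with eventually_gt_at_top[of 0] show ?thesis
    proof eventually_elim
      case (elim t)
      let ?p = "prob {\<omega> \<in> space M. t * \<alpha> < X \<omega>}"
      have "?p \<noteq> 0" using elim by auto
      then have "0 < ?p" by (simp add: less_le)
      moreover have "- c * t < ln ?p" using elim by (simp add: field_simps)
      ultimately show ?case using ln_ge_iff[of ?p "- c * t"] by simp
    qed
  qed
  have marginal_upper: "\<forall>\<^sub>F t in at_top. prob {\<omega> \<in> space M. t * \<alpha> < X \<omega>} < exp (- c * t)"
    if X: "((\<lambda>t. ln (prob {\<omega> \<in> space M. t * \<alpha> < X \<omega>}) / t) \<longlongrightarrow> - 1) at_top" and "c < 1" for X \<alpha> c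
  proof -
    have "\<forall>\<^sub>F t in at_top. ln (prob {\<omega> \<in> space M. t * \<alpha> < X \<omega>}) / t < - c"
      "\<forall>\<^sub>F t in at_top. ln (prob {\<omega> \<in> space M. t * \<alpha> < X \<omega>}) / t < 0"
      using order_tendstoD[OF X] \<open>c < 1\<close> by auto
    with eventually_gt_at_top[of 0] show ?thesis
    proof eventually_elim
      case (elim t)
      let ?p = "prob {\<omega> \<in> space M. t * \<alpha> < X \<omega>}"
      have "?p \<noteq> 0" using elim by auto
      then have "0 < ?p" by (simp add: less_le)
      moreover have "ln ?p < - c * t" using elim by (simp add: field_simps)
      ultimately show ?case using ln_less_cancel_iff[of ?p "exp (- c * t)"] by simp
    qed
  qed
  \<comment> \<open>At \<open>t = L q / c\<close> the bound \<open>exp (- c * t)\<close> equals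
    \<open>1 - q\<close>, so the distribution function of \<open>X\<close> at
    \<open>t * \<alpha>\<close> is at most \<open>q\<close>, and exceeding \<open>q\<close> forces
    \<open>X\<close> above this threshold; likewise for \<open>Y\<close>.\<close>
  have R_upper: "\<forall>\<^sub>F q in at_left 1. R q \<le> Q (L q / c)" if "1 < c" for c
  proof -
    have "\<forall>\<^sub>F q in at_left 1. exp (- c * (L q / c)) \<le> prob {\<omega> \<in> space M. L q / c * \<alpha> < X \<omega>}"
      "\<forall>\<^sub>F q in at_left 1. exp (- c * (L q / c)) \<le> prob {\<omega> \<in> space M. L q / c * \<gamma> < Y \<omega>}"
      using that eventually_compose_filterlim[OF marginal_lower[OF X, of c] Lc[of c]]
        eventually_compose_filterlim[OF marginal_lower[OF Y, of c] Lc[of c]]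
      by simp_all
    with q1 show ?thesis
    proof eventually_elim
      case (elim q)
      let ?t = "L q / c"
      have *: "distr_fun M X (?t * \<alpha>) \<le> q" "distr_fun M Y (?t * \<gamma>) \<le> q"
        using elim that one_minus_distr_fun[of X "?t * \<alpha>"] one_minus_distr_fun[of Y "?t * \<gamma>"] exp_L[of q]
        by simp_all
      have "?t * \<alpha> < X \<omega> \<and> ?t * \<gamma> < Y \<omega>"
        if "q < distr_fun M X (X \<omega>)" "q < distr_fun M Y (Y \<omega>)" for \<omega>
      proof (rule ccontr)
        assume "\<not> (?t * \<alpha> < X \<omega> \<and> ?t * \<gamma> < Y \<omega>)"
        then consider "X \<omega> \<le> ?t * \<alpha>" | "Y \<omega> \<le> ?t * \<gamma>" by linarith
        then show False
          using * that distr_fun_mono[of X "X \<omega>" "?t * \<alpha>"] distr_fun_mono[of Y "Y \<omega>" "?t * \<gamma>"]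
          by cases auto
      qed
      then show ?case unfolding R_def Q_def by (intro finite_measure_mono) auto
    qed
  qed
  have R_lower: "\<forall>\<^sub>F q in at_left 1. Q (L q / c) \<le> R q" if "0 < c" "c < 1" for c
  proof -
    have "\<forall>\<^sub>F q in at_left 1. prob {\<omega> \<in> space M. L q / c * \<alpha> < X \<omega>} < exp (- c * (L q / c))"
      "\<forall>\<^sub>F q in at_left 1. prob {\<omega> \<in> space M. L q / c * \<gamma> < Y \<omega>} < exp (- c * (L q / c))"
      using that eventually_compose_filterlim[OF marginal_upper[OF X, of c] Lc[of c]]
        eventually_compose_filterlim[OF marginal_upper[OF Y, of c] Lc[of c]]
      by simp_all
    with q1 show ?thesis
    proof eventually_elim
      case (elim q)
      let ?t = "L q / c"
      have *: "q < distr_fun M X (?t * \<alpha>)" "q < distr_fun M Y (?t * \<gamma>)"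
        using elim that one_minus_distr_fun[of X "?t * \<alpha>"] one_minus_distr_fun[of Y "?t * \<gamma>"] exp_L[of q]
        by simp_all
      have "q < distr_fun M X (X \<omega>) \<and> q < distr_fun M Y (Y \<omega>)"
        if "?t * \<alpha> < X \<omega>" "?t * \<gamma> < Y \<omega>" for \<omega>
        using * that distr_fun_mono[of X "?t * \<alpha>" "X \<omega>"] distr_fun_mono[of Y "?t * \<gamma>" "Y \<omega>"]
        by auto
      then show ?case unfolding R_def Q_def by (intro finite_measure_mono) auto
    qed
  qed
  have L_pos: "\<forall>\<^sub>F q in at_left 1. 0 < L q"
    using L by (simp add: filterlim_at_top_dense)
  have "((\<lambda>q. ln (R q) / L q) \<longlongrightarrow> - (1 / V)) (at_left 1)"
  proof (rule order_tendstoI)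
    fix l assume l: "l < - (1 / V)"
    have "((\<lambda>c. - (1 / V) / c) \<longlongrightarrow> - (1 / V) / 1) (at_left 1)"
      by (intro tendsto_intros) auto
    then have "\<forall>\<^sub>F c in at_left 1. l < - (1 / V) / c" using l by (intro order_tendstoD) auto
    moreover have "\<forall>\<^sub>F c in at_left 1. c \<in> {0<..<1::real}"
      by (rule eventually_at_leftI[of 0]) auto
    ultimately have "\<forall>\<^sub>F c in at_left 1. l < - (1 / V) / c \<and> 0 < c \<and> c < 1"
      by eventually_elim auto
    then obtain c where c: "l < - (1 / V) / c" "0 < c" "c < 1"
      using eventually_happens[of _ "at_left (1::real)"] by auto
    have "\<forall>\<^sub>F q in at_left 1. l < ln (Q (L q / c)) / L q"
      using order_tendstoD(1)[OF Q_lim[OF c(2)] c(1)] .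
    moreover have "\<forall>\<^sub>F q in at_left 1. 0 < Q (L q / c)"
      by (rule eventually_compose_filterlim[OF Q_pos Lc[OF c(2)]])
    ultimately show "\<forall>\<^sub>F q in at_left 1. l < ln (R q) / L q"
      using L_pos R_lower[OF c(2,3)]
    proof eventually_elim
      case (elim q)
      then have "ln (Q (L q / c)) / L q \<le> ln (R q) / L q"
        by (intro divide_right_mono) auto
      then show ?case using elim by linarith
    qed
  next
    fix u assume u: "- (1 / V) < u"
    have "((\<lambda>c. - (1 / V) / c) \<longlongrightarrow> - (1 / V) / 1) (at_right 1)"
      by (intro tendsto_intros) auto
    then have "\<forall>\<^sub>F c in at_right 1. - (1 / V) / c < u" using u by (intro order_tendstoD) auto
    moreover have "\<forall>\<^sub>F c in at_right 1. c \<in> {1<..<2::real}"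
      by (rule eventually_at_rightI[of _ 2]) auto
    ultimately have "\<forall>\<^sub>F c in at_right 1. - (1 / V) / c < u \<and> 1 < c"
      by eventually_elim auto
    then obtain c where c: "- (1 / V) / c < u" "1 < c"
      using eventually_happens[of _ "at_right (1::real)"] by auto
    have "\<forall>\<^sub>F q in at_left 1. ln (Q (L q / c)) / L q < u"
      using order_tendstoD(2)[OF Q_lim c(1)] c(2) by auto
    \<comment> \<open>The lower estimate with \<open>c = 1 / 2\<close> provides
      \<open>R q > 0\<close>, so that monotonicity of \<open>ln\<close> applies to the upper
      estimate.\<close>
    moreover have "\<forall>\<^sub>F q in at_left 1. 0 < Q (L q / (1 / 2))"
      by (rule eventually_compose_filterlim[OF Q_pos Lc]) simp
    moreover have "\<forall>\<^sub>F q in at_left 1. Q (L q / (1 / 2)) \<le> R q"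
      by (rule R_lower) auto
    ultimately show "\<forall>\<^sub>F q in at_left 1. ln (R q) / L q < u"
      using L_pos R_upper[OF c(2)]
    proof eventually_elim
      case (elim q)
      then have "ln (R q) / L q \<le> ln (Q (L q / c)) / L q"
        by (intro divide_right_mono) auto
      then show ?case using elim by linarith
    qed
  qed
  then have "((\<lambda>q. - inverse (ln (R q) / L q)) \<longlongrightarrow> - inverse (- (1 / V))) (at_left 1)"
    using \<open>0 < V\<close> by (intro tendsto_intros) auto
  then show ?thesis
    using \<open>0 < V\<close> by (simp add: has_residual_tail_dependence_def R_def L_def inverse_eq_divide)
qed

text \<open>The coefficient is the value of the game with rows \<open>a i / Max (a\<close>
  I)\<open>and\<close>b i / Max (b \<open>I)\<close>. It is described by two inequalities: an
  optimal \<open>w\<close> gives lower bounds at every index, and \<open>w = 1 / 2\<close> an upper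
  bound at some index.\<close>

lemma indep_sums_residual_tail_dependence:
  fixes Z :: "'i \<Rightarrow> 'a \<Rightarrow> real"
  assumes I: "finite I" "I \<noteq> {}" "indep_vars (\<lambda>_. borel) Z I" and "0 < \<beta>"
    and tail: "\<And>i. i \<in> I \<Longrightarrow> (\<lambda>x. 1 - distr_fun M (Z i) x) \<in> exp_tail_class \<beta>"
    and ab: "\<And>i. i \<in> I \<Longrightarrow> 0 < a i" "\<And>i. i \<in> I \<Longrightarrow> 0 < b i"
  obtains V w where
    "has_residual_tail_dependence M (\<lambda>\<omega>. \<Sum>i\<in>I. a i * Z i \<omega>) (\<lambda>\<omega>. \<Sum>i\<in>I. b i * Z i \<omega>) V"
    "0 \<le> w" "w \<le> 1" "\<And>i. i \<in> I \<Longrightarrow> w * (a i / Max (a ` I)) + (1 - w) * (b i / Max (b ` I)) \<le> V"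
    "\<exists>i\<in>I. V \<le> (a i / Max (a ` I) + b i / Max (b ` I)) / 2"
proof -
  define A where "A = Max (a ` I)"
  define B where "B = Max (b ` I)"
  have "A \<in> a ` I" "B \<in> b ` I" using I by (auto simp: A_def B_def)
  then obtain iA iB where iA: "iA \<in> I" "a iA = A" and iB: "iB \<in> I" "b iB = B" by auto
  have AB: "0 < A" "0 < B" using ab(1)[OF iA(1)] ab(2)[OF iB(1)] iA iB by auto
  have le: "a i \<le> A" "b i \<le> B" if "i \<in> I" for i
    using I that by (auto simp: A_def B_def)
  obtain p w V where p: "\<And>i. i \<in> I \<Longrightarrow> 0 \<le> p i" "sum p I = 1" and w01: "0 \<le> w" "w \<le> 1"
    and V: "V \<le> (\<Sum>i\<in>I. p i * (a i / A))" "V \<le> (\<Sum>i\<in>I. p i * (b i / B))"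
    and wV: "\<And>i. i \<in> I \<Longrightarrow> w * (a i / A) + (1 - w) * (b i / B) \<le> V"
    by (rule minimax_two_rows[OF I(1,2), of "\<lambda>i. a i / A" "\<lambda>i. b i / B"]) (rule that)
  have "0 < w * (a iA / A) + (1 - w) * (b iA / B)"
  proof (cases "w = 0")
    case False
    then show ?thesis using w01 ab(1)[OF iA(1)] ab(2)[OF iA(1)] AB by (intro add_pos_nonneg) auto
  qed (use ab(2)[OF iA(1)] AB in auto)
  also have "\<dots> \<le> V" by (rule wV[OF iA(1)])
  finally have "0 < V" .
  have Z[measurable]: "Z i \<in> borel_measurable M" if "i \<in> I" for i
    using I(3) that by (auto simp: indep_vars_def)
  note rate = indep_sums_joint_tail_rate[OF I \<open>0 < \<beta>\<close> tail]
  \<comment> \<open>A marginal tail is the joint tail of a sum with itself: the value is 1, attained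
    by the point mass \<open>e\<close> at an index with the largest coefficient.\<close>
  have marginal: "((\<lambda>t. ln (prob {\<omega> \<in> space M. t * (c j / \<beta>) < (\<Sum>i\<in>I. c i * Z i \<omega>)}) / t) \<longlongrightarrow> - 1) at_top"
    if c: "j \<in> I" "\<And>i. i \<in> I \<Longrightarrow> 0 < c i" "\<And>i. i \<in> I \<Longrightarrow> c i \<le> c j" for c j
  proof -
    define e :: "'i \<Rightarrow> real" where "e i = (if i = j then 1 else 0)" for i
    have e: "sum e I = 1" "0 \<le> e i" for i
      using I(1) c(1) by (simp_all add: e_def)
    have "e i * (c i / c j) = e i" for i
      using c(2)[OF c(1)] by (simp add: e_def)
    then have "(\<Sum>i\<in>I. e i * (c i / c j)) = 1"
      using e(1) by presburger
    with e show ?thesis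
      using rate[of c c "c j" "c j" 1 e 0] c by simp
  qed
  have "has_residual_tail_dependence M (\<lambda>\<omega>. \<Sum>i\<in>I. a i * Z i \<omega>) (\<lambda>\<omega>. \<Sum>i\<in>I. b i * Z i \<omega>) V"
  proof (rule has_residual_tail_dependenceI)
    show "((\<lambda>t. ln (prob {\<omega> \<in> space M. t * (A / \<beta>) < (\<Sum>i\<in>I. a i * Z i \<omega>)}) / t) \<longlongrightarrow> - 1) at_top"
      using marginal[of iA a] iA ab le by simp
    show "((\<lambda>t. ln (prob {\<omega> \<in> space M. t * (B / \<beta>) < (\<Sum>i\<in>I. b i * Z i \<omega>)}) / t) \<longlongrightarrow> - 1) at_top"
      using marginal[of iB b] iB ab le by simp
    show "((\<lambda>t. ln (prob {\<omega> \<in> space M. t * (A / \<beta>) < (\<Sum>i\<in>I. a i * Z i \<omega>) \<and>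
        t * (B / \<beta>) < (\<Sum>i\<in>I. b i * Z i \<omega>)}) / t) \<longlongrightarrow> - (1 / V)) at_top"
      by (rule rate[OF _ ab AB \<open>0 < V\<close> p V w01 wV]) auto
  qed (use \<open>0 < V\<close> in measurable)
  \<comment> \<open>\<open>V\<close> is at most the \<open>p\<close>-average of the row means, so
    some row mean reaches it; an index with \<open>p j > 0\<close> makes the contradiction
    strict.\<close>
  moreover have "\<exists>i\<in>I. V \<le> (a i / A + b i / B) / 2"
  proof (rule ccontr)
    assume "\<not> ?thesis"
    then have less: "(a i / A + b i / B) / 2 < V" if "i \<in> I" for i
      using that by (meson not_le)
    obtain j where j: "j \<in> I" "p j \<noteq> 0" using p(2) by (metis sum.neutral zero_neq_one)
    have "(\<Sum>i\<in>I. p i * ((a i / A + b i / B) / 2)) < (\<Sum>i\<in>I. p i * V)"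
    proof (rule sum_strict_mono_ex1[OF I(1)])
      show "\<forall>i\<in>I. p i * ((a i / A + b i / B) / 2) \<le> p i * V"
        using p(1) less by (intro ballI mult_left_mono) (auto intro: less_imp_le)
      have "0 < p j" using p(1)[OF j(1)] j(2) by linarith
      then show "\<exists>i\<in>I. p i * ((a i / A + b i / B) / 2) < p i * V"
        using less[OF j(1)] j(1) by (intro bexI[of _ j] mult_strict_left_mono)
    qed
    also have "\<dots> = V" using p(2) by (simp flip: sum_distrib_right)
    also have "V \<le> ((\<Sum>i\<in>I. p i * (a i / A)) + (\<Sum>i\<in>I. p i * (b i / B))) / 2"
      using V by simp
    also have "\<dots> = (\<Sum>i\<in>I. p i * ((a i / A + b i / B) / 2))"
      by (simp add: sum.distrib sum_divide_distrib algebra_simps add_divide_distrib)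
    finally show False by simp
  qed
  ultimately show thesis
    by (intro that[of V w]) (use w01 wV in \<open>simp_all add: A_def B_def\<close>)
qed

end

subsection \<open>Triangulated cells\<close>

lemma full_simplex_closure_interior:
  fixes T :: "'a::euclidean_space set"
  assumes "int DIM('a) simplex T"
  shows "interior T \<noteq> {}" "closure (interior T) = T"
proof -
  have "affine hull T = UNIV"
    using aff_dim_simplex[OF assms] by (simp add: aff_dim_eq_full)
  then have *: "rel_interior T = interior T" by (simp add: rel_interior_interior)
  have "T \<noteq> {}" using assms by auto
  then show "interior T \<noteq> {}"
    using rel_interior_eq_empty[OF convex_simplex[OF assms]] * by simp
  show "closure (interior T) = T"
    using convex_closure_rel_interior[OF convex_simplex[OF assms]] closed_simplex[OF assms] *
    by simp
qed

text \<open>A vertex may be assigned to a neighbouring cell, or to none on the boundary, but a cell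
  always contains the interior of its triangle. A node is therefore located only up to
  closure.\<close>

lemma triangulated_partition_node_cell:
  assumes "triangulated_partition B N J C" "a \<in> N"
  obtains i where "i \<in> {1..J}" "a \<in> closure (interior (C i))"
proof -
  obtain T i where "i \<in> {1..J}" "a extreme_point_of T i" "2 simplex T i" "interior (T i) \<subseteq> C i"
    using assms unfolding triangulated_partition_def by blast
  then have "a \<in> closure (interior (T i))" "interior (T i) \<subseteq> interior (C i)"
    using full_simplex_closure_interior[of "T i"]
    by (auto simp: extreme_point_of_def interior_maximal)
  then show thesis using that[OF \<open>i \<in> {1..J}\<close>] closure_mono by blast
qed

text \<open>These facts bring each cell under the tail hypothesis; its measure is positive since it
  contains a nonempty open set.\<close>

lemma triangulated_partition_cell:
  assumes "triangulated_partition B N J C" "i \<in> {1..J}"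
  shows "C i \<in> sets borel" "C i \<subseteq> B" "bounded (C i)" "0 < emeasure lborel (C i)"
proof -
  obtain T where T: "2 simplex T" "interior T \<subseteq> C i" "C i \<subseteq> T"
    using assms unfolding triangulated_partition_def by blast
  show "C i \<in> sets borel" "C i \<subseteq> B"
    using assms unfolding triangulated_partition_def by blast+
  show "bounded (C i)"
    using T compact_simplex compact_imp_bounded bounded_subset by blast
  have "\<not> negligible (interior T)"
    using full_simplex_closure_interior(1)[of T] T(1) by (simp add: open_not_negligible)
  then have "0 < emeasure lborel (interior T)"
    by (simp add: negligible_iff_emeasure0 zero_less_iff_neq_zero)
  also have "\<dots> \<le> emeasure lborel (C i)"
    using T \<open>C i \<in> sets borel\<close> by (intro emeasure_mono) auto
  finally show "0 < emeasure lborel (C i)" .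
qed

text \<open>A point of \<open>D\<close> may lie on the boundary, where the mesh width is not controlled; it is however a
  limit of nodes, hence of interior points of \<open>D\<close>.\<close>

lemma eventually_near_cell:
  assumes tri: "\<And>n. triangulated_partition (Dn n) (Mn n) (J n) (C n)"
    and sub: "\<And>n. Dn n \<subseteq> D"
    and d: "\<And>n i. i \<in> {1..J n} \<Longrightarrow> d n i \<in> C n i"
    and fine: "locally_fine D J C" and dense: "dense_nodes D Mn"
    and "s \<in> D" "0 < \<epsilon>"
  shows "\<forall>\<^sub>F n in sequentially. \<exists>i\<in>{1..J n}. dist (d n i) s < \<epsilon>"
proof -
  have node: "\<exists>a. (\<forall>n. a n \<in> Mn n) \<and> (\<forall>\<^sub>F n in sequentially. dist (a n) x < r)"
    if "x \<in> D" "0 < r" for x r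
  proof -
    obtain a where "\<forall>n. a n \<in> Mn n" "(\<lambda>n. dist (a n) x) \<longlonglongrightarrow> 0"
      using dense \<open>x \<in> D\<close> unfolding dense_nodes_def by blast
    then show ?thesis using order_tendstoD(2)[OF _ \<open>0 < r\<close>] by blast
  qed
  have near: "\<exists>i\<in>{1..J n}. \<exists>y\<in>interior (C n i). dist y x < r" if a: "a \<in> Mn n" "dist a x < r" for n a x r
  proof -
    obtain i where i: "i \<in> {1..J n}" "a \<in> closure (interior (C n i))"
      using triangulated_partition_node_cell[OF tri a(1)] .
    then obtain y where "y \<in> interior (C n i)" "dist y a < r - dist a x"
      using a(2) unfolding closure_approachable by (auto dest: spec[of _ "r - dist a x"])
    moreover have "dist y x \<le> dist y a + dist a x" by (rule dist_triangle)
    ultimately show ?thesis using i(1) by force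
  qed
  have C_sub: "C n i \<subseteq> D" if "i \<in> {1..J n}" for n i
    using triangulated_partition_cell(2)[OF tri that] sub by blast
  \<comment> \<open>A single mesh with a node near \<open>s\<close> suffices to find
    \<open>x\<close>; the mesh width is then controlled around this fixed interior point.\<close>
  obtain x where x: "x \<in> interior D" "dist x s < \<epsilon> / 2"
  proof -
    obtain a where "\<forall>n. a n \<in> Mn n" "\<forall>\<^sub>F n in sequentially. dist (a n) s < \<epsilon> / 2"
      using node[OF \<open>s \<in> D\<close>, of "\<epsilon> / 2"] \<open>0 < \<epsilon>\<close> by auto
    then obtain n where "dist (a n) s < \<epsilon> / 2" "a n \<in> Mn n"
      by (meson eventually_happens' sequentially_bot)
    then obtain i y where "i \<in> {1..J n}" "y \<in> interior (C n i)" "dist y s < \<epsilon> / 2"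
      using near by blast
    then show thesis using that[of y] interior_mono[OF C_sub] by blast
  qed
  obtain r where r: "0 < r" "cball x r \<subseteq> interior D"
    using x(1) open_contains_cball[of "interior D"] by auto
  \<comment> \<open>The error splits into \<open>\<epsilon> / 4\<close> for the cell diameter,
    \<open>\<epsilon> / 4\<close> for the distance from the cell to \<open>x\<close>, and
    \<open>\<epsilon> / 2\<close> for the distance from \<open>x\<close> to
    \<open>s\<close>.\<close>
  define \<delta> where "\<delta> = min r (\<epsilon> / 4)"
  have \<delta>: "0 < \<delta>" "\<delta> \<le> \<epsilon> / 4" "cball x \<delta> \<subseteq> interior D"
    using r \<open>0 < \<epsilon>\<close> by (auto simp: \<delta>_def)
  obtain a where a: "\<forall>n. a n \<in> Mn n" "\<forall>\<^sub>F n in sequentially. dist (a n) x < \<delta>"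
    using node[of x \<delta>] x(1) \<delta>(1) interior_subset by blast
  have "\<forall>\<^sub>F n in sequentially. \<forall>i\<in>{1..J n}. C n i \<inter> cball x \<delta> \<noteq> {} \<longrightarrow> diameter (C n i) < \<epsilon> / 4"
    using fine[unfolded locally_fine_def, rule_format, of "cball x \<delta>" "\<epsilon> / 4"] \<delta>(3) \<open>0 < \<epsilon>\<close>
    by simp
  with a(2) show ?thesis
  proof eventually_elim
    case (elim n)
    then obtain i y where i: "i \<in> {1..J n}" and y: "y \<in> C n i" "dist y x < \<delta>"
      using near[of "a n" n x \<delta>] a(1) interior_subset by blast
    then have "diameter (C n i) < \<epsilon> / 4"
      using elim(2) by (force simp: dist_commute)
    moreover have "dist (d n i) y \<le> diameter (C n i)"
      using d[OF i] y triangulated_partition_cell(3)[OF tri i] by (intro diameter_bounded_bound)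
    moreover have "dist (d n i) s \<le> dist (d n i) y + dist y x + dist x s"
      using dist_triangle[of "d n i" s y] dist_triangle[of y s x] by linarith
    ultimately show ?case using i y \<delta>(2) x(2) by (intro bexI[of _ i]) auto
  qed
qed

lemma cells_indep_vars:
  assumes "prob_space P" "independently_scattered P D M"
    and tri: "triangulated_partition B N J C" and "B \<subseteq> D"
  shows "prob_space.indep_vars P (\<lambda>_. borel) (\<lambda>i. M (C i)) {1..J}"
proof -
  interpret prob_space P by fact
  \<comment> \<open>Independent scattering speaks of sequences of sets, so the finite family is
    padded with empty sets.\<close>
  define A where "A i = (if i \<in> {1..J} then C i else {})" for i
  have "disjoint_family A"
    using tri by (auto simp: A_def triangulated_partition_def disjoint_family_on_def)
  moreover have "C i \<in> bounded_borel_subsets D" if "i \<in> {1..J}" for i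
    using triangulated_partition_cell[OF tri that] \<open>B \<subseteq> D\<close>
    by (auto simp: bounded_borel_subsets_def)
  moreover have "{} \<in> bounded_borel_subsets D"
    by (simp add: bounded_borel_subsets_def)
  ultimately have "disjoint_family A" "range A \<subseteq> bounded_borel_subsets D"
    by (auto simp: A_def)
  then have "indep_vars (\<lambda>_. borel) (\<lambda>i. M (A i)) UNIV"
    using assms(2) unfolding independently_scattered_def by blast
  then have "indep_vars (\<lambda>_. borel) (\<lambda>i. M (A i)) {1..J}"
    by (rule indep_vars_subset) simp
  then show ?thesis
    by (subst indep_vars_cong[where Y="\<lambda>i. M (A i)"]) (auto simp: A_def)
qed

section \<open>Convergence of the coefficients as the mesh gets fine\<close>

theorem theorem4p1:
  fixes P :: "'w measure"
    and D :: "(real^2) set"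
    and M :: "(real^2) set \<Rightarrow> 'w \<Rightarrow> real"
    and G :: "real \<Rightarrow> real"
    and u :: "real^2 \<Rightarrow> 'w \<Rightarrow> real"
    and \<beta> :: real
    and Dn :: "nat \<Rightarrow> (real^2) set"
    and J :: "nat \<Rightarrow> nat"
    and C :: "nat \<Rightarrow> nat \<Rightarrow> (real^2) set"
    and Mn :: "nat \<Rightarrow> (real^2) set"
    and d :: "nat \<Rightarrow> nat \<Rightarrow> real^2"
    and s\<^sub>1 s\<^sub>2 :: "real^2"
  assumes "prob_space P"
    and "D \<in> sets borel"
    and "independently_scattered P D M"
    and "moving_average P D M G u"
    and G_nonneg: "\<And>x. 0 \<le> x \<Longrightarrow> 0 \<le> G x"
    and G_cont: "continuous_on {0..} G"
    and G_decreasing: "strict_antimono_on {0..} G"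
    and G_convex: "convex_on {0..} G"
    and "0 < \<beta>"
    and tails: "\<And>B. B \<in> bounded_borel_subsets D \<Longrightarrow> 0 < emeasure lborel B \<Longrightarrow>
           abs_continuous_df (distr_fun P (M B)) \<and>
           (\<lambda>x. 1 - distr_fun P (M B) x) \<in> exp_tail_class \<beta>"
    and "\<And>n. Dn n \<in> bounded_borel_subsets D"
    and "incseq Dn"
    and "\<And>n. triangulated_partition (Dn n) (Mn n) (J n) (C n)"
    and "\<And>n i. i \<in> {1..J n} \<Longrightarrow> d n i \<in> C n i"
    and fine: "locally_fine D J C"
    and "s\<^sub>1 \<in> D" and "s\<^sub>2 \<in> D" and "s\<^sub>1 \<noteq> s\<^sub>2"
    and "filterlim (\<lambda>n. card (Mn n)) at_top sequentially"
    and "dense_nodes D Mn"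
  shows "\<exists>\<eta> :: nat \<Rightarrow> real.
           (\<forall>n. has_residual_tail_dependence P
              (integral_approx M G (J n) (C n) (d n) s\<^sub>1)
              (integral_approx M G (J n) (C n) (d n) s\<^sub>2) (\<eta> n)) \<and>
           \<eta> \<longlonglongrightarrow> 1 / 2 + G (norm (s\<^sub>1 - s\<^sub>2)) / (2 * G 0)"
proof -
  interpret prob_space P by fact
  note tri = \<open>\<And>n. triangulated_partition (Dn n) (Mn n) (J n) (C n)\<close>
  note d = \<open>\<And>n i. i \<in> {1..J n} \<Longrightarrow> d n i \<in> C n i\<close>
  have sub: "Dn n \<subseteq> D" for n
    using \<open>Dn n \<in> bounded_borel_subsets D\<close> by (simp add: bounded_borel_subsets_def)
  define h where "h = norm (s\<^sub>1 - s\<^sub>2)"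
  define a where "a n i = G (norm (s\<^sub>1 - d n i))" for n i
  define b where "b n i = G (norm (s\<^sub>2 - d n i))" for n i
  define A where "A n = Max (a n ` {1..J n})" for n
  define B where "B n = Max (b n ` {1..J n})" for n
  have G_less: "G y < G x" if "0 \<le> x" "x < y" for x y
    using G_decreasing that by (auto simp: monotone_on_def)
  have G_anti: "G y \<le> G x" if "0 \<le> x" "x \<le> y" for x y
    using G_less[of x y] that by (cases "x = y") auto
  have G_pos: "0 < G x" if "0 \<le> x" for x
    using G_less[of x "x + 1"] G_nonneg[of "x + 1"] that by simp
  have ab_pos: "0 < a n i" "0 < b n i" for n i by (simp_all add: a_def b_def G_pos)
  have ab_le: "a n i \<le> G 0" "b n i \<le> G 0" for n i by (simp_all add: a_def b_def G_anti)
  have ne: "{1..J n} \<noteq> {}" for n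
  proof -
    obtain v where "v \<in> Mn n"
      using \<open>dense_nodes D Mn\<close> \<open>s\<^sub>1 \<in> D\<close> unfolding dense_nodes_def by blast
    then show ?thesis using triangulated_partition_node_cell[OF tri] by blast
  qed
  have tail: "(\<lambda>x. 1 - distr_fun P (M (C n i)) x) \<in> exp_tail_class \<beta>" if "i \<in> {1..J n}" for n i
    using tails[of "C n i"] triangulated_partition_cell[OF tri that] sub[of n]
    by (auto simp: bounded_borel_subsets_def)
  have "\<exists>V w. has_residual_tail_dependence P
        (integral_approx M G (J n) (C n) (d n) s\<^sub>1) (integral_approx M G (J n) (C n) (d n) s\<^sub>2) V \<and>
      0 \<le> w \<and> w \<le> 1 \<and> (\<forall>i\<in>{1..J n}. w * (a n i / A n) + (1 - w) * (b n i / B n) \<le> V) \<and>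
      (\<exists>i\<in>{1..J n}. V \<le> (a n i / A n + b n i / B n) / 2)" for n
  proof -
    note indep = cells_indep_vars[OF \<open>prob_space P\<close> \<open>independently_scattered P D M\<close> tri sub, of n]
    show ?thesis
      unfolding A_def B_def integral_approx_def[abs_def] a_def[symmetric] b_def[symmetric]
      by (rule indep_sums_residual_tail_dependence[where a="a n" and b="b n",
            OF finite_atLeastAtMost ne indep \<open>0 < \<beta>\<close> tail ab_pos]) blast+
  qed
  then obtain V w where
    V: "\<And>n. has_residual_tail_dependence P
        (integral_approx M G (J n) (C n) (d n) s\<^sub>1) (integral_approx M G (J n) (C n) (d n) s\<^sub>2) (V n)"
    and w: "\<And>n. 0 \<le> w n" "\<And>n. w n \<le> 1"
    and lower: "\<And>n i. i \<in> {1..J n} \<Longrightarrow> w n * (a n i / A n) + (1 - w n) * (b n i / B n) \<le> V n"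
    and upper: "\<And>n. \<exists>i\<in>{1..J n}. V n \<le> (a n i / A n + b n i / B n) / 2"
    by metis
  have Max: "a n i \<le> A n" "b n i \<le> B n" if "i \<in> {1..J n}" for n i
    using that by (auto simp: A_def B_def)
  have "A n \<in> a n ` {1..J n}" "B n \<in> b n ` {1..J n}" for n
    using ne[of n] by (simp_all add: A_def B_def)
  then have AB: "0 < A n" "A n \<le> G 0" "0 < B n" "B n \<le> G 0" for n
    using ab_pos ab_le by (metis (no_types, lifting) imageE)+

  have nearest: "\<exists>k. (\<forall>n. k n \<in> {1..J n}) \<and> (\<lambda>n. d n (k n)) \<longlonglongrightarrow> s" if "s \<in> D" for s
  proof -
    \<comment> \<open>Choosing the nearest sample point at each \<open>n\<close> gives one sequence
      that works for every \<open>\<epsilon>\<close>.\<close>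
    define k where "k n = arg_min_on (\<lambda>i. dist (d n i) s) {1..J n}" for n
    have k: "k n \<in> {1..J n}" "\<And>i. i \<in> {1..J n} \<Longrightarrow> dist (d n (k n)) s \<le> dist (d n i) s" for n
      using arg_min_if_finite[OF finite_atLeastAtMost ne[of n], where f="\<lambda>i. dist (d n i) s"]
      by (auto simp: k_def not_less)
    have "(\<lambda>n. d n (k n)) \<longlonglongrightarrow> s"
    proof (rule tendstoI)
      fix \<epsilon> :: real assume "0 < \<epsilon>"
      have "\<forall>\<^sub>F n in sequentially. \<exists>i\<in>{1..J n}. dist (d n i) s < \<epsilon>"
        by (rule eventually_near_cell[OF tri sub d fine \<open>dense_nodes D Mn\<close> that \<open>0 < \<epsilon>\<close>])
      then show "\<forall>\<^sub>F n in sequentially. dist (d n (k n)) s < \<epsilon>"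
        by eventually_elim (use k in \<open>meson le_less_trans\<close>)
    qed
    then show ?thesis using k by blast
  qed
  have G_lim: "(\<lambda>n. G (norm (s - x n))) \<longlonglongrightarrow> G (norm (s - l))" if "x \<longlonglongrightarrow> l" for x :: "nat \<Rightarrow> real^2" and s l
    by (rule continuous_on_tendsto_compose[OF G_cont]) (auto intro!: tendsto_intros that)
  obtain k where k: "\<And>n. k n \<in> {1..J n}" "(\<lambda>n. d n (k n)) \<longlonglongrightarrow> s\<^sub>1"
    using nearest[OF \<open>s\<^sub>1 \<in> D\<close>] by blast
  obtain l where l: "\<And>n. l n \<in> {1..J n}" "(\<lambda>n. d n (l n)) \<longlonglongrightarrow> s\<^sub>2"
    using nearest[OF \<open>s\<^sub>2 \<in> D\<close>] by blast
  have ak: "(\<lambda>n. a n (k n)) \<longlonglongrightarrow> G 0" and bk: "(\<lambda>n. b n (k n)) \<longlonglongrightarrow> G h"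
    using G_lim[OF k(2), of s\<^sub>1] G_lim[OF k(2), of s\<^sub>2] by (simp_all add: a_def b_def h_def norm_minus_commute)
  have al: "(\<lambda>n. a n (l n)) \<longlonglongrightarrow> G h" and bl: "(\<lambda>n. b n (l n)) \<longlonglongrightarrow> G 0"
    using G_lim[OF l(2), of s\<^sub>1] G_lim[OF l(2), of s\<^sub>2] by (simp_all add: a_def b_def h_def)
  \<comment> \<open>The maximum lies between the value at the cell near \<open>s\<^sub>1\<close>,
    which tends to \<open>G 0\<close>, and \<open>G 0\<close> itself.\<close>
  have A_lim: "A \<longlonglongrightarrow> G 0"
    by (rule tendsto_sandwich[OF _ _ ak tendsto_const]) (use Max k AB in auto)
  have B_lim: "B \<longlonglongrightarrow> G 0"
    by (rule tendsto_sandwich[OF _ _ bl tendsto_const]) (use Max l AB in auto)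
  have G0: "G 0 \<noteq> 0" "G h \<le> G 0" using G_pos[of 0] by (auto simp: h_def G_anti)

  \<comment> \<open>Nothing is known about the optimal weight \<open>w n\<close>. Restricting to the
    cells \<open>k n\<close> and \<open>l n\<close> and taking minima gives a symmetric two by two
    game with entries \<open>m n\<close> and \<open>r n\<close>; adding the bounds from its two
    columns eliminates \<open>w n\<close>.\<close>
  define m where "m n = min (a n (k n) / A n) (b n (l n) / B n)" for n
  define r where "r n = min (b n (k n) / B n) (a n (l n) / A n)" for n
  have "(m n + r n) / 2 \<le> V n" for n
  proof -
    have "w n * m n + (1 - w n) * r n \<le> w n * (a n (k n) / A n) + (1 - w n) * (b n (k n) / B n)"
      "w n * r n + (1 - w n) * m n \<le> w n * (a n (l n) / A n) + (1 - w n) * (b n (l n) / B n)"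
      using w by (intro add_mono mult_left_mono; simp add: m_def r_def)+
    then have "w n * m n + (1 - w n) * r n \<le> V n" "w n * r n + (1 - w n) * m n \<le> V n"
      using lower[OF k(1)[of n]] lower[OF l(1)[of n]] by linarith+
    then show ?thesis by (simp add: algebra_simps)
  qed
  \<comment> \<open>The index attaining the upper bound may be anywhere in the mesh. Passing to the
    common denominator \<open>min (A n) (B n)\<close> leaves \<open>a n i + b n i\<close>, which the
    triangle inequality and convexity of \<open>G\<close> bound uniformly in
    \<open>i\<close>.\<close>
  moreover have "V n \<le> (G 0 + G h) / (2 * min (A n) (B n))" for n
  proof -
    obtain i where i: "V n \<le> (a n i / A n + b n i / B n) / 2" using upper by blast
    have "a n i / A n + b n i / B n \<le> a n i / min (A n) (B n) + b n i / min (A n) (B n)"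
      using ab_pos[of n i] AB[of n] by (intro add_mono divide_left_mono) auto
    also have "\<dots> = (a n i + b n i) / min (A n) (B n)" by (simp add: add_divide_distrib)
    also have "\<dots> \<le> (G 0 + G h) / min (A n) (B n)"
    proof (rule divide_right_mono)
      have "h \<le> norm (s\<^sub>1 - d n i) + norm (s\<^sub>2 - d n i)"
        unfolding h_def using dist_triangle2[of s\<^sub>1 s\<^sub>2 "d n i"] by (simp add: dist_norm)
      then show "a n i + b n i \<le> G 0 + G h"
        unfolding a_def b_def using G_convex G_anti
        by (intro convex_on_add_le_boundary) (auto simp: monotone_on_def h_def)
    qed (use AB[of n] in simp)
    finally show ?thesis using i by simp
  qed
  moreover have "(\<lambda>n. (m n + r n) / 2) \<longlonglongrightarrow> (min (G 0 / G 0) (G 0 / G 0) + min (G h / G 0) (G h / G 0)) / 2"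
    unfolding m_def r_def using G0 by (intro tendsto_intros A_lim B_lim ak bk al bl) auto
  then have "(\<lambda>n. (m n + r n) / 2) \<longlonglongrightarrow> 1 / 2 + G h / (2 * G 0)"
    using G0 by (simp add: add_divide_distrib mult.commute)
  moreover have "(\<lambda>n. (G 0 + G h) / (2 * min (A n) (B n))) \<longlonglongrightarrow> (G 0 + G h) / (2 * min (G 0) (G 0))"
    using G0 by (intro tendsto_intros A_lim B_lim) auto
  then have "(\<lambda>n. (G 0 + G h) / (2 * min (A n) (B n))) \<longlonglongrightarrow> 1 / 2 + G h / (2 * G 0)"
    using G0 by (simp add: add_divide_distrib mult.commute)
  ultimately have "V \<longlonglongrightarrow> 1 / 2 + G h / (2 * G 0)"
    by (intro tendsto_sandwich[of "\<lambda>n. (m n + r n) / 2" V _ "\<lambda>n. (G 0 + G h) / (2 * min (A n) (B n))"]) auto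
  then show ?thesis using V unfolding h_def by blast
qed

end
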